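(* Let $b<a$ and $p\in(0,1)$, and let $\xi$ be an integrable real random variable with $\mathbb P(\xi>a)=\mathbb P(\xi\in(b,a))=0$, $\mathbb P(\xi=a)=p$, and $\mathbb P(\xi\in(b-\varepsilon,b])>0$ for all $\varepsilon>0$. For $N\ge1$ let $\{\xi_{i,j}(s):1\le i,j\le N, s\ge1\}$ be i.i.d. copies of $\xi$, $X(0)\in\mathbb R^N$, and $X_i(t+1)=\max_{1\le j\le N}\{X_j(t)+\xi_{i,j}(t+1)\}$. Let $v_N=\lim_{t\to\infty}t^{-1}\max_{1\le i\le N}X_i(t)$ be the speed of the front (this limit exists almost surely and is deterministic). Then, as $N\to\infty$, $$v_N=a-(a-b)(1-p)^{N^2}2^N+o\big((1-p)^{N^2}2^N\big).$$ *)

theory Defs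
  imports "HOL-Probability.Probability" "HOL-Library.Landau_Symbols"
begin

fun front_proc :: "nat \<Rightarrow> (nat \<Rightarrow> real) \<Rightarrow> (nat \<Rightarrow> nat \<Rightarrow> nat \<Rightarrow> real) \<Rightarrow> nat \<Rightarrow> nat \<Rightarrow> real" where
  "front_proc N x0 xi 0 i = x0 i"
| "front_proc N x0 xi (Suc t) i = Max ((\<lambda>j. front_proc N x0 xi t j + xi i j (Suc t)) ` {1..N})"

definition front_max :: "nat \<Rightarrow> (nat \<Rightarrow> real) \<Rightarrow> (nat \<Rightarrow> nat \<Rightarrow> nat \<Rightarrow> real) \<Rightarrow> nat \<Rightarrow> real" where
  "front_max N x0 xi t = Max ((\<lambda>i. front_proc N x0 xi t i) ` {1..N})"

end

theory Submission
  imports Defs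
begin

text \<open>
  Put \<open>q = 1 - p\<close>.  Compare the front with a greedy process that remembers only the particles attaining
  the maximum (the leaders): rounding the weights below \<open>a\<close> up to \<open>b\<close> makes it an upper bound, leaving
  them unchanged makes it a lower bound.  From \<open>k\<close> leaders, the front fails to advance by \<open>a\<close> with
  probability \<open>q ^ (k * N)\<close>, and otherwise the number of leaders becomes binomial with parameters \<open>N\<close> and
  \<open>1 - q ^ k\<close>.  A failure costs \<open>a - b + o(1)\<close>, because the best of at least \<open>N\<close> weights conditioned to be
  at most \<open>b\<close> is close to \<open>b\<close>.  So everything reduces to \<open>E (q ^ (N * k)) \<sim> 2 ^ N * q ^ N\<^sup>2\<close>.

  Since \<open>E (q ^ (m * Bin(N, 1 - q ^ k))) \<le> (q ^ k + q ^ m) ^ N\<close>, the moments \<open>E (q ^ (m * k))\<close>, divided by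
  \<open>q ^ (m * N)\<close>, satisfy a closed linear recursion in \<open>m\<close> with binomial coefficients.  The supersolution
  \<open>1 + R ^ N * y ^ (N - m)\<close> controls it for \<open>1 \<le> m < N\<close>, uniformly in time, and one further step of the
  recursion yields the constant \<open>2 ^ N\<close> at \<open>m = N\<close>.
\<close>

section \<open>The moment recursion\<close>

text \<open>The factor 2^N shows up one step after a state in which all N particles lead: having l
  non-leaders then costs about q^(N l), and failing from the remaining N - l leaders costs q^(N (N -
  l)). All l weigh the same, so their binomial coefficients add up. The obstacle is that states with
  few leaders fail far more often, and the stationary law of the leader count is not explicit.
  Bounds uniform in time take its place. Dividing the m-th moment by q^(m N), its value when
  everyone leads, makes 1 the typical size, and it remains to show that the recursion does not
  amplify. In the supersolution, the summand 1 is this typical size, while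
  \<open>R ^ N * y ^ (N - m)\<close> pays for small leader sets. That second summand has to absorb
  (1 + q)^N already at m = N - 1, which forces R > 1 + q; yet its share (R (1 + y))^N in the last
  step must not exceed the order 2^N. These competing demands fix R and y. The speed is given only
  as an almost sure limit, so a truncation argument is needed to compare it with mean
  displacements.\<close>

lemma eventually_power_le:
  fixes x c y :: real
  assumes "0 \<le> x" "x < y" "0 < c"
  shows "\<forall>\<^sub>F n in sequentially. x ^ n \<le> c * y ^ n"
proof -
  have "(\<lambda>n. (x / y) ^ n) \<longlonglongrightarrow> 0"
    using assms by (intro LIMSEQ_realpow_zero) auto
  then have "\<forall>\<^sub>F n in sequentially. (x / y) ^ n < c"
    using assms(3) by (rule order_tendstoD)
  then show ?thesis
  proof eventually_elim
    case (elim n)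
    then show ?case using assms by (simp add: power_divide divide_less_eq)
  qed
qed

lemma eventually_one_plus_power_le:
  fixes \<gamma> c :: real
  assumes "0 \<le> \<gamma>" "\<gamma> < 1" "0 < c"
  shows "\<forall>\<^sub>F n in sequentially. (1 + \<gamma> ^ n) ^ n - 1 \<le> c"
proof -
  have "(\<lambda>n. real n * \<gamma> ^ n) \<longlonglongrightarrow> 0"
    using assms powser_times_n_limit_0[of \<gamma>] by simp
  then have "(\<lambda>n. exp (real n * \<gamma> ^ n)) \<longlonglongrightarrow> exp 0"
    by (intro tendsto_intros)
  then have "\<forall>\<^sub>F n in sequentially. exp (real n * \<gamma> ^ n) < 1 + c"
    using assms(3) by (intro order_tendstoD) auto
  then show ?thesis
  proof eventually_elim
    case (elim n)
    have "(1 + \<gamma> ^ n) ^ n \<le> exp (\<gamma> ^ n) ^ n"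
      using assms by (intro power_mono) (auto simp: exp_ge_add_one_self)
    also have "\<dots> = exp (real n * \<gamma> ^ n)"
      by (simp add: exp_of_nat_mult)
    finally show ?case using elim by simp
  qed
qed

text \<open>With s = N - m, the left side is what the recursion makes of the supersolution, apart
  from a constant. If s is at most N/d, the weight R^N y^s dominates, because R > 1 + q and (y +
  q)^N decays faster than y^s. If s is larger, q^s is exponentially small in N: the first difference
  is then close to 0, and the second term is governed by R y < 1.\<close>

lemma eventually_power_sum_le_weight:
  fixes q R y \<eta> :: real
  assumes q: "0 < q" "q < 1" and \<eta>: "0 < \<eta>"
    and y: "0 < y" "y + q < 1" and R: "1 + q < R" "R * y < 1"
  shows "\<forall>\<^sub>F N in sequentially. \<forall>s\<ge>1.
           (1 + q ^ s) ^ N - 1 + R ^ N * (y + q ^ s) ^ N \<le> \<eta> * (1 + R ^ N * y ^ s)"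
proof -
  have R0: "0 < R" using q R by linarith
  \<comment> \<open>\<beta> beats both rates (1 + q)/R and y + q but stays below 1; once
    \<open>\<beta> ^ d < y\<close>, the condition d s \<le> N yields
    \<open>\<beta> ^ N \<le> y ^ s\<close>.\<close>
  obtain \<beta> where \<beta>: "max ((1 + q) / R) (y + q) < \<beta>" "\<beta> < 1"
    using dense[of "max ((1 + q) / R) (y + q)" 1] y R q by auto
  have \<beta>0: "0 < \<beta>" using \<beta>(1) y q by (auto simp: max_def split: if_splits)
  have R\<beta>: "1 + q < R * \<beta>" using \<beta> R0 by (simp add: field_simps)
  have "(\<lambda>n. \<beta> ^ n) \<longlonglongrightarrow> 0" using \<beta> \<beta>0 by (intro LIMSEQ_realpow_zero) auto
  then have "\<forall>\<^sub>F n in sequentially. \<beta> ^ n < y"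
    using y(1) by (rule order_tendstoD)
  then have "\<forall>\<^sub>F n in sequentially. \<beta> ^ n < y \<and> 1 \<le> n"
    using eventually_ge_at_top[of 1] by eventually_elim auto
  then obtain d where d: "\<beta> ^ d < y" "1 \<le> d"
    using eventually_happens by fastforce
  \<comment> \<open>A rational substitute for the d-th root of q: Bernoulli's inequality gives
    \<open>q \<le> \<gamma> ^ d\<close>, and \<gamma> is still below 1.\<close>
  define \<gamma> where "\<gamma> = 1 - (1 - q) / real d"
  have "(1 - q) / real d \<le> (1 - q) / 1" using d q by (intro divide_left_mono) auto
  then have \<gamma>: "0 < \<gamma>" "\<gamma> < 1" using d q by (auto simp: \<gamma>_def)
  have q\<gamma>: "q \<le> \<gamma> ^ d"
    using Bernoulli_inequality[of "- ((1 - q) / real d)" d] \<gamma> d by (simp add: \<gamma>_def)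
  obtain y' where y': "y < y'" "R * y' < 1"
    using dense[of y "1 / R"] R R0 by (auto simp: field_simps)
  have "(\<lambda>n. \<gamma> ^ n) \<longlonglongrightarrow> 0" using \<gamma> by (intro LIMSEQ_realpow_zero) auto
  then have ev1: "\<forall>\<^sub>F n in sequentially. \<gamma> ^ n < y' - y"
    using y' by (intro order_tendstoD) auto
  have ev2: "\<forall>\<^sub>F n in sequentially. (1 + \<gamma> ^ n) ^ n - 1 \<le> \<eta> / 2"
    using \<gamma> \<eta> by (intro eventually_one_plus_power_le) auto
  have ev3: "\<forall>\<^sub>F n in sequentially. (R * y') ^ n \<le> \<eta> / 2 * 1 ^ n"
    using R0 y y' \<eta> by (intro eventually_power_le) auto
  have ev4: "\<forall>\<^sub>F n in sequentially. (1 + q) ^ n \<le> \<eta> / 2 * (R * \<beta>) ^ n"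
    using q R\<beta> \<eta> by (intro eventually_power_le) auto
  have ev5: "\<forall>\<^sub>F n in sequentially. (y + q) ^ n \<le> \<eta> / 2 * \<beta> ^ n"
    using q y \<beta> \<eta> by (intro eventually_power_le) auto
  from ev1 ev2 ev3 ev4 ev5 show ?thesis
  proof eventually_elim
    case (elim N)
    show ?case
    proof (intro allI impI)
      fix s :: nat assume s: "1 \<le> s"
      have qs: "0 < q ^ s" "q ^ s \<le> q" using q s power_decreasing[of 1 s q] by auto
      show "(1 + q ^ s) ^ N - 1 + R ^ N * (y + q ^ s) ^ N \<le> \<eta> * (1 + R ^ N * y ^ s)"
      proof (cases "d * s \<le> N")
        case True
        have "\<beta> ^ N \<le> \<beta> ^ (d * s)" using True \<beta> \<beta>0 by (intro power_decreasing) auto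
        also have "\<dots> \<le> y ^ s" unfolding power_mult using d \<beta>0 by (intro power_mono) auto
        finally have \<beta>y: "\<beta> ^ N \<le> y ^ s" .
        have "(1 + q ^ s) ^ N \<le> (1 + q) ^ N" using qs q by (intro power_mono) auto
        also have "\<dots> \<le> \<eta> / 2 * (R ^ N * \<beta> ^ N)" using elim by (simp add: power_mult_distrib)
        also have "\<dots> \<le> \<eta> / 2 * (R ^ N * y ^ s)" using \<beta>y \<eta> R0 by (intro mult_left_mono) auto
        finally have A: "(1 + q ^ s) ^ N \<le> \<eta> / 2 * (R ^ N * y ^ s)" .
        have "(y + q ^ s) ^ N \<le> (y + q) ^ N" using qs q y by (intro power_mono) auto
        also have "\<dots> \<le> \<eta> / 2 * \<beta> ^ N" using elim by simp
        also have "\<dots> \<le> \<eta> / 2 * y ^ s" using \<beta>y \<eta> by (intro mult_left_mono) auto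
        finally have "R ^ N * (y + q ^ s) ^ N \<le> R ^ N * (\<eta> / 2 * y ^ s)"
          using R0 by (intro mult_left_mono) auto
        then show ?thesis using A \<eta> by (simp add: algebra_simps)
      next
        case False
        have "q ^ s \<le> \<gamma> ^ (d * s)" unfolding power_mult using q\<gamma> q by (intro power_mono) auto
        also have "\<dots> \<le> \<gamma> ^ N" using False \<gamma> by (intro power_decreasing) auto
        finally have q\<gamma>N: "q ^ s \<le> \<gamma> ^ N" .
        have "(1 + q ^ s) ^ N \<le> (1 + \<gamma> ^ N) ^ N" using qs q\<gamma>N by (intro power_mono) auto
        then have A: "(1 + q ^ s) ^ N - 1 \<le> \<eta> / 2" using elim by simp
        have "(R * (y + q ^ s)) ^ N \<le> (R * y') ^ N"
          using R0 y qs q\<gamma>N elim by (intro power_mono mult_left_mono) auto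
        then have "R ^ N * (y + q ^ s) ^ N \<le> \<eta> / 2" using elim by (simp add: power_mult_distrib)
        moreover have "0 \<le> \<eta> * (R ^ N * y ^ s)" using \<eta> R0 y by simp
        ultimately show ?thesis using A by (simp add: algebra_simps)
      qed
    qed
  qed
qed

text \<open>The term l = N is split off because in the moment recursion it cancels against the
  correction for failures.\<close>

lemma binomial_sum_less:
  fixes x y :: real
  shows "(\<Sum>l<N. real (N choose l) * x ^ l * y ^ (N - l)) = (x + y) ^ N - x ^ N"
  unfolding binomial_ring lessThan_Suc_atMost[symmetric] by simp

text \<open>The auxiliary bound \<open>crude\<close> is the supersolution argument; \<open>fine\<close> feeds it once through the
  recursion, which replaces the factor \<open>K\<close> by \<open>1\<close> up to small terms.\<close>

lemma binomial_recursion_bound: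
  fixes w :: "nat \<Rightarrow> nat \<Rightarrow> real" and q R y \<eta> K :: real
  assumes q: "0 < q" "q < 1" and y: "0 < y" and R: "0 < R" and N: "1 \<le> N"
    and \<eta>: "0 < \<eta>" "\<eta> \<le> (1 - q) / 2" and K: "K = 2 / (1 - q)"
    and key: "\<And>s. 1 \<le> s \<Longrightarrow>
           (1 + q ^ s) ^ N - 1 + R ^ N * (y + q ^ s) ^ N \<le> \<eta> * (1 + R ^ N * y ^ s)"
    and w0: "\<And>t. w 0 t = 1" and init: "\<And>m. m \<le> N \<Longrightarrow> w m 0 = 1"
    and rec: "\<And>m t. m \<le> N \<Longrightarrow> w m (Suc t) \<le>
           (\<Sum>l<N. real (N choose l) * (q ^ (N - m)) ^ l * w l t) + q ^ m * w m t"
  shows "w N t \<le> (2 ^ N + K * (\<eta> * (2 ^ N + (R * (1 + y)) ^ N)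
           + ((1 + q) ^ N + (R * (q + y)) ^ N))) / (1 - q ^ N)"
proof -
  define h where "h m = 1 + R ^ N * y ^ (N - m)" for m
  have h1: "1 \<le> h m" for m using y R by (simp add: h_def)
  have K1: "1 \<le> K" "0 < K" using q by (auto simp: K field_simps)
  \<comment> \<open>The self term leaves a slack of (1 - q) K h. The choice of K lets one half
    absorb the constant 1, the bound on \<eta> lets the other half absorb K \<eta> h.\<close>
  have Kh: "1 + K * \<eta> * h m + q * (K * h m) \<le> K * h m" for m
  proof -
    have "K * ((1 - q) / 2) = 1" using q by (simp add: K)
    with h1[of m] have "1 \<le> K * ((1 - q) / 2) * h m" by (metis mult_1)
    moreover have "K * \<eta> * h m \<le> K * ((1 - q) / 2) * h m"
      using \<eta> K1 h1[of m] by (intro mult_right_mono mult_left_mono) auto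
    ultimately show ?thesis by (simp add: algebra_simps)
  qed
  have step: "w m (Suc t) \<le> 1 + K * \<eta> * h m + q ^ m * (K * h m)"
    if m: "1 \<le> m" "m < N" and IH: "\<And>l. 1 \<le> l \<Longrightarrow> l < N \<Longrightarrow> w l t \<le> K * h l" for m t
  proof -
    define z where "z = q ^ (N - m)"
    have z: "0 < z" using q by (simp add: z_def)
    \<comment> \<open>At l = 0 the exact value 1 replaces the bound K h 0. This turns the leading
      constant K into 1; with K there, the induction would not close.\<close>
    have "(\<Sum>l<N. real (N choose l) * z ^ l * w l t)
        \<le> (\<Sum>l<N. real (N choose l) * z ^ l * (K * h l) - (if l = 0 then K * h l - 1 else 0))"
    proof (rule sum_mono)
      fix l assume "l \<in> {..<N}"
      then show "real (N choose l) * z ^ l * w l t \<le> real (N choose l) * z ^ l * (K * h l)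
          - (if l = 0 then K * h l - 1 else 0)"
        using IH[of l] z w0 by (auto intro!: mult_left_mono)
    qed
    also have "\<dots> = K * ((\<Sum>l<N. real (N choose l) * z ^ l * 1 ^ (N - l))
        + R ^ N * (\<Sum>l<N. real (N choose l) * z ^ l * y ^ (N - l))) - (K * h 0 - 1)"
      using N by (simp add: sum_subtractf h_def algebra_simps sum.distrib sum_distrib_left)
    also have "\<dots> = K * ((z + 1) ^ N - z ^ N + R ^ N * ((z + y) ^ N - z ^ N)) - (K * h 0 - 1)"
      unfolding binomial_sum_less by simp
    also have "\<dots> \<le> 1 + K * ((1 + z) ^ N - 1 + R ^ N * (y + z) ^ N)"
    proof -
      have "0 \<le> K * (z ^ N + R ^ N * z ^ N)" "0 \<le> K * (R ^ N * y ^ N)"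
        using K1 z R y by auto
      then show ?thesis by (simp add: h_def algebra_simps)
    qed
    also have "\<dots> \<le> 1 + K * (\<eta> * h m)"
      using key[of "N - m"] m K1 unfolding h_def z_def
      by (intro add_left_mono mult_left_mono) auto
    finally have S: "(\<Sum>l<N. real (N choose l) * z ^ l * w l t) \<le> 1 + K * \<eta> * h m"
      by (simp add: mult.assoc)
    have "q ^ m * w m t \<le> q ^ m * (K * h m)"
      using IH m q by (intro mult_left_mono) auto
    then show ?thesis using rec[of m t] S m by (simp add: z_def)
  qed
  have crude: "w m t \<le> K * h m" if "1 \<le> m" "m < N" for m t
    using that
  proof (induction t arbitrary: m)
    case 0
    then show ?case using init[of m] mult_mono[of 1 K 1 "h m"] h1[of m] K1 by simp
  next
    case (Suc t)
    have "w m (Suc t) \<le> 1 + K * \<eta> * h m + q ^ m * (K * h m)"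
      using Suc by (intro step) auto
    also have "\<dots> \<le> 1 + K * \<eta> * h m + q * (K * h m)"
      using q Suc.prems power_decreasing[of 1 m q] K1 h1[of m]
      by (intro add_left_mono mult_right_mono) auto
    also have "\<dots> \<le> K * h m" by (rule Kh)
    finally show ?case .
  qed
  have fine: "w m t \<le> 1 + K * \<eta> * h m + q ^ m * (K * h m)" if "m < N" for m t
  proof (cases "m = 0 \<or> t = 0")
    case True
    have "0 \<le> K * \<eta> * h m + q ^ m * (K * h m)" using K1 \<eta> h1[of m] q by simp
    moreover have "w m t = 1" using True w0 init that by auto
    ultimately show ?thesis by simp
  next
    case False
    then show ?thesis using step[of m "t - 1"] crude that by (cases t) auto
  qed
  define B where "B = 2 ^ N + K * (\<eta> * (2 ^ N + (R * (1 + y)) ^ N)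
           + ((1 + q) ^ N + (R * (q + y)) ^ N))"
  have B1: "1 \<le> B"
  proof -
    have "0 \<le> K * (\<eta> * (2 ^ N + (R * (1 + y)) ^ N) + ((1 + q) ^ N + (R * (q + y)) ^ N))"
      using K1 \<eta> R y q by (intro mult_nonneg_nonneg add_nonneg_nonneg zero_le_power) auto
    moreover have "(1::real) \<le> 2 ^ N" by simp
    ultimately show ?thesis unfolding B_def by linarith
  qed
  have qN: "q ^ N < 1" using q N power_Suc_less_one[of q "N - 1"] by simp
  \<comment> \<open>At m = N the weights \<open>(q ^ (N - m)) ^ l\<close> are all 1, so the four
    parts of the refined bound sum to plain binomials; the first is the main term 2^N. The feedback
    through \<open>q ^ N\<close> only costs the geometric factor 1 / (1 - q^N).\<close>
  have recN: "w N (Suc t) \<le> B + q ^ N * w N t" for t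
  proof -
    have "(\<Sum>l<N. real (N choose l) * (q ^ (N - N)) ^ l * w l t)
        \<le> (\<Sum>l<N. real (N choose l) * (1 + K * \<eta> * h l + q ^ l * (K * h l)))"
      using fine by (intro sum_mono) (auto intro!: mult_left_mono)
    also have "\<dots> = (\<Sum>l<N. real (N choose l) * 1 ^ l * 1 ^ (N - l))
        + K * (\<eta> * ((\<Sum>l<N. real (N choose l) * 1 ^ l * 1 ^ (N - l))
            + R ^ N * (\<Sum>l<N. real (N choose l) * 1 ^ l * y ^ (N - l)))
          + ((\<Sum>l<N. real (N choose l) * q ^ l * 1 ^ (N - l))
            + R ^ N * (\<Sum>l<N. real (N choose l) * q ^ l * y ^ (N - l))))"
      by (simp add: h_def algebra_simps sum.distrib sum_distrib_left)
    also have "\<dots> \<le> B"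
      unfolding binomial_sum_less B_def power_mult_distrib using K1 \<eta> R q
      by (intro add_mono mult_left_mono) (auto simp: add.commute[of 1 q])
    finally show ?thesis using rec[of N t] by simp
  qed
  have "w N t \<le> B / (1 - q ^ N)"
  proof (induction t)
    case 0
    have "0 < q ^ N" using q by simp
    then show ?case using init[of N] B1 qN by (simp add: field_simps)
  next
    case (Suc t)
    have "w N (Suc t) \<le> B + q ^ N * (B / (1 - q ^ N))"
      using recN[of t] Suc q mult_left_mono[of "w N t" "B / (1 - q ^ N)" "q ^ N"] by simp
    also have "\<dots> = B / (1 - q ^ N)" using qN by (simp add: field_simps)
    finally show ?case .
  qed
  then show ?thesis by (simp add: B_def)
qed


text \<open>For k = N and z = q^N the right side is ((2 - z) z)^N - z^N, and N z tends to 0. For k <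
  N the base x exceeds 2 c z with c > 1, so x^N is exponentially larger than needed; the subtraction
  is harmless since x^N - (q^k)^N is at least (x - q^k) x^(N - 1).\<close>

lemma eventually_one_step_failure_ge:
  fixes q \<eta> :: real
  assumes q: "0 < q" "q < 1" and \<eta>: "0 < \<eta>"
  shows "\<forall>\<^sub>F N in sequentially. \<forall>k\<in>{1..N}.
           (1 - \<eta>) * 2 ^ N * q ^ (N\<^sup>2) \<le> (q ^ k + (1 - q ^ k) * q ^ N) ^ N - (q ^ k) ^ N"
proof -
  \<comment> \<open>For k < N one has q^k \<ge> z/q, so x/z is at least about 1 + 1/q, which is
    greater than 2; c keeps part of this margin.\<close>
  obtain c where c: "1 < c" "2 * c < 1 + 1 / q"
    using dense[of 1 "(1 + 1 / q) / 2"] q by (auto simp: field_simps)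
  have "(\<lambda>N. 1 + (1 - q ^ N) / q) \<longlonglongrightarrow> 1 + (1 - 0) / q"
    using q by (intro tendsto_intros LIMSEQ_realpow_zero) auto
  then have ev1: "\<forall>\<^sub>F N in sequentially. 2 * c < 1 + (1 - q ^ N) / q"
    using c by (intro order_tendstoD) auto
  have ev2: "\<forall>\<^sub>F N in sequentially. 1 ^ N \<le> (1 - q) / (2 * c) * c ^ N"
    using c q by (intro eventually_power_le) auto
  have ev3: "\<forall>\<^sub>F N in sequentially. (1 / 2) ^ N \<le> \<eta> / 2 * 1 ^ N"
    using \<eta> by (intro eventually_power_le) auto
  have "(\<lambda>N. real N * q ^ N) \<longlonglongrightarrow> 0"
    using q powser_times_n_limit_0[of q] by simp
  then have ev4: "\<forall>\<^sub>F N in sequentially. real N * q ^ N < \<eta>"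
    using \<eta> by (rule order_tendstoD)
  show ?thesis
    using ev1 ev2 ev3 ev4 eventually_ge_at_top[of 1]
  proof eventually_elim
    case (elim N)
    define z where "z = q ^ N"
    have z: "0 < z" "z \<le> 1" using q by (auto simp: z_def power_le_one)
    have zN: "q ^ (N\<^sup>2) = z ^ N" by (simp add: z_def power_mult power2_eq_square)
    show ?case
    proof
      fix k assume k: "k \<in> {1..N}"
      define x where "x = q ^ k + (1 - q ^ k) * z"
      show "(1 - \<eta>) * 2 ^ N * q ^ (N\<^sup>2) \<le> (q ^ k + (1 - q ^ k) * q ^ N) ^ N - (q ^ k) ^ N"
      proof (cases "k = N")
        case True
        have "1 - \<eta> / 2 \<le> 1 + real N * (- (z / 2))" using elim by (simp add: z_def)
        also have "\<dots> \<le> (1 + - (z / 2)) ^ N" using z by (intro Bernoulli_inequality) auto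
        finally have "2 ^ N * (1 - \<eta> / 2) \<le> 2 ^ N * (1 - z / 2) ^ N"
          by simp
        also have "\<dots> = (2 - z) ^ N" by (simp flip: power_mult_distrib)
        finally have A: "2 ^ N * (1 - \<eta> / 2) \<le> (2 - z) ^ N" .
        have "1 \<le> \<eta> / 2 * 2 ^ N" using elim by (simp add: power_divide field_simps)
        with A have "(1 - \<eta>) * 2 ^ N \<le> (2 - z) ^ N - 1" by (simp add: algebra_simps)
        then have "(1 - \<eta>) * 2 ^ N * z ^ N \<le> ((2 - z) ^ N - 1) * z ^ N"
          using z by (intro mult_right_mono) auto
        also have "\<dots> = ((2 - z) * z) ^ N - z ^ N" by (subst left_diff_distrib) (simp only: power_mult_distrib mult_1)
        also have "(2 - z) * z = z + (1 - z) * z" by (simp add: algebra_simps)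
        finally show ?thesis unfolding zN using True by (simp add: z_def)
      next
        case False
        have qk: "z / q \<le> q ^ k" "q ^ k \<le> q" "0 < q ^ k"
        proof -
          have "q ^ N \<le> q ^ Suc k" using False k q by (intro power_decreasing) auto
          then show "z / q \<le> q ^ k" using q by (simp add: z_def field_simps)
          show "q ^ k \<le> q" using power_decreasing[of 1 k q] q k by simp
        qed (use q in simp)
        have "z * (2 * c) \<le> z * (1 + (1 - z) / q)"
          using elim z by (intro mult_left_mono) (auto simp: z_def)
        also have "\<dots> = z / q * (1 - z) + z" by (simp add: field_simps)
        also have "\<dots> \<le> q ^ k * (1 - z) + z"
          using qk z by (intro add_right_mono mult_right_mono) auto
        also have "\<dots> = x" by (simp add: x_def algebra_simps)
        finally have zx: "z * (2 * c) \<le> x" .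
        have x0: "q ^ k \<le> x" using qk q z by (simp add: x_def)
        have x1: "(1 - q) * z \<le> x - q ^ k" using qk z by (simp add: x_def)
        obtain n where n: "N = Suc n" using elim by (cases N) auto
        have "1 \<le> (1 - q) / 2 * c ^ n" using elim c by (simp add: n)
        then have "(1 - \<eta>) * (2 ^ N * z ^ N) \<le> ((1 - q) / 2 * c ^ n) * (2 ^ N * z ^ N)"
          using z \<eta> by (intro mult_right_mono) auto
        also have "\<dots> = (1 - q) * z * (z * (2 * c)) ^ n"
          by (simp add: n power_mult_distrib)
        also have "\<dots> \<le> (x - q ^ k) * x ^ n"
          using zx x1 z c q x0 by (intro mult_mono power_mono) auto
        also have "\<dots> = x ^ N - q ^ k * x ^ n" by (simp add: n algebra_simps)
        also have "q ^ k * x ^ n \<ge> q ^ k * (q ^ k) ^ n"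
          using x0 qk by (intro mult_left_mono power_mono) auto
        then have "x ^ N - q ^ k * x ^ n \<le> x ^ N - (q ^ k) ^ N" by (simp add: n)
        finally show ?thesis unfolding zN by (simp add: x_def z_def mult.assoc)
      qed
    qed
  qed
qed

section \<open>The greedy process\<close>

definition gain :: "nat \<Rightarrow> (nat \<times> nat \<times> nat \<Rightarrow> real) \<Rightarrow> nat \<Rightarrow> nat set \<Rightarrow> real" where
  "gain N y t S = Max ((\<lambda>e. y e) ` ({1..N} \<times> S \<times> {t}))"

text \<open>Everyone leads at time 0, whatever the initial positions; these enter only through the
  additive constant \<open>c\<close> of the comparison lemmas.\<close>

fun leaders :: "nat \<Rightarrow> (nat \<times> nat \<times> nat \<Rightarrow> real) \<Rightarrow> nat \<Rightarrow> nat set" where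
  "leaders N y 0 = {1..N}"
| "leaders N y (Suc t) =
     {i \<in> {1..N}. \<exists>j\<in>leaders N y t. y (i, j, Suc t) = gain N y (Suc t) (leaders N y t)}"

definition level :: "nat \<Rightarrow> (nat \<times> nat \<times> nat \<Rightarrow> real) \<Rightarrow> nat \<Rightarrow> real" where
  "level N y t = (\<Sum>s<t. gain N y (Suc s) (leaders N y s))"

lemma level_Suc: "level N y (Suc t) = level N y t + gain N y (Suc t) (leaders N y t)"
  by (simp add: level_def)

lemma gain_ge:
  assumes "i \<in> {1..N}" "j \<in> S" "S \<subseteq> {1..N}"
  shows "y (i, j, t) \<le> gain N y t S"
  unfolding gain_def using assms finite_subset[OF assms(3)] by (intro Max_ge) auto

lemma gain_attained:
  assumes "1 \<le> N" "S \<noteq> {}" "S \<subseteq> {1..N}"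
  obtains i j where "i \<in> {1..N}" "j \<in> S" "gain N y t S = y (i, j, t)"
proof -
  have "gain N y t S \<in> (\<lambda>e. y e) ` ({1..N} \<times> S \<times> {t})"
    unfolding gain_def using assms finite_subset[OF assms(3)] by (intro Max_in) auto
  then show ?thesis using that by auto
qed

lemma leaders_subset: "leaders N y t \<subseteq> {1..N}"
  by (cases t) auto

lemma leaders_nonempty:
  assumes "1 \<le> N"
  shows "leaders N y t \<noteq> {}"
proof (induction t)
  case (Suc t)
  obtain i j where "i \<in> {1..N}" "j \<in> leaders N y t"
    "gain N y (Suc t) (leaders N y t) = y (i, j, Suc t)"
    using gain_attained[OF assms Suc leaders_subset] by metis
  then have "i \<in> leaders N y (Suc t)" by auto
  then show ?case by blast
qed (use assms in auto)

text \<open>Restricting the update to edges that leave leaders can only lower the maximum, and each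
  new leader is the endpoint of such an edge attaining the gain. So every leader, and with it the
  front, stays at or above the greedy level.\<close>

lemma level_le_front_max:
  assumes N: "1 \<le> N" and x0: "\<And>i. i \<in> {1..N} \<Longrightarrow> c \<le> x0 i"
    and xi: "\<And>i j s. i \<in> {1..N} \<Longrightarrow> j \<in> {1..N} \<Longrightarrow> 1 \<le> s \<Longrightarrow> y (i, j, s) \<le> xi i j s"
  shows "c + level N y t \<le> front_max N x0 xi t"
proof -
  have *: "c + level N y t \<le> front_proc N x0 xi t i" if "i \<in> leaders N y t" for i
    using that
  proof (induction t arbitrary: i)
    case (Suc t)
    then obtain j where j: "i \<in> {1..N}" "j \<in> leaders N y t"
      "y (i, j, Suc t) = gain N y (Suc t) (leaders N y t)" by auto
    have jN: "j \<in> {1..N}" using j leaders_subset by blast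
    have "c + level N y (Suc t) \<le> front_proc N x0 xi t j + xi i j (Suc t)"
      using Suc.IH[OF j(2)] xi[OF j(1) jN, of "Suc t"] j(3) by (simp add: level_Suc)
    also have "\<dots> \<le> front_proc N x0 xi (Suc t) i"
      using jN by (auto intro!: Max_ge)
    finally show ?case .
  qed (auto simp: level_def x0)
  obtain i where i: "i \<in> leaders N y t" using leaders_nonempty[OF N] by blast
  then have "i \<in> {1..N}" using leaders_subset by blast
  then have "front_proc N x0 xi t i \<le> front_max N x0 xi t"
    unfolding front_max_def by (intro Max_ge) auto
  with *[OF i] show ?thesis by simp
qed

text \<open>With weights \<open>a\<close> and \<open>b\<close> only, every non-leader stays at distance at least \<open>a - b\<close> behind the
  front, so it cannot overtake, and if the front moves by \<open>b\<close> all particles become leaders.\<close>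

lemma front_max_le_level:
  assumes N: "1 \<le> N" and ab: "b \<le> a" and x0: "\<And>i. i \<in> {1..N} \<Longrightarrow> x0 i \<le> c"
    and xi: "\<And>i j s. i \<in> {1..N} \<Longrightarrow> j \<in> {1..N} \<Longrightarrow> 1 \<le> s \<Longrightarrow> xi i j s \<le> y (i, j, s)"
    and y: "\<And>e. y e = a \<or> y e = b"
  shows "front_max N x0 xi t \<le> c + level N y t"
proof -
  have *: "front_proc N x0 xi t i \<le> c + level N y t - (if i \<in> leaders N y t then 0 else a - b)"
    if "i \<in> {1..N}" for i
    using that
  proof (induction t arbitrary: i)
    case (Suc t)
    define g where "g = gain N y (Suc t) (leaders N y t)"
    have "g = a \<or> g = b" unfolding g_def
      by (metis y gain_attained[OF N leaders_nonempty[OF N] leaders_subset])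
    have "front_proc N x0 xi t j + xi i j (Suc t)
        \<le> c + level N y (Suc t) - (if i \<in> leaders N y (Suc t) then 0 else a - b)"
      if j: "j \<in> {1..N}" for j
    proof -
      have X: "front_proc N x0 xi t j \<le> c + level N y t - (if j \<in> leaders N y t then 0 else a - b)"
        by (rule Suc.IH[OF j])
      have Z: "xi i j (Suc t) \<le> y (i, j, Suc t)" using xi[OF Suc.prems j] by simp
      have Y: "y (i, j, Suc t) = a \<or> y (i, j, Suc t) = b" by (rule y)
      show ?thesis
      proof (cases "j \<in> leaders N y t")
        case True
        have "y (i, j, Suc t) \<le> g"
          unfolding g_def using True Suc.prems leaders_subset by (intro gain_ge) auto
        moreover have "i \<notin> leaders N y (Suc t) \<Longrightarrow> y (i, j, Suc t) \<noteq> g"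
          using True Suc.prems by (auto simp: g_def)
        ultimately show ?thesis
          using X Y Z True ab \<open>g = a \<or> g = b\<close>
          by (auto simp del: leaders.simps simp: level_Suc g_def[symmetric] split: if_splits)
      next
        case False
        have "i \<notin> leaders N y (Suc t) \<Longrightarrow> g = a"
        proof (rule ccontr)
          assume i: "i \<notin> leaders N y (Suc t)" and "g \<noteq> a"
          then have g: "g = b" using \<open>g = a \<or> g = b\<close> by simp
          obtain j' where j': "j' \<in> leaders N y t" using leaders_nonempty[OF N] by blast
          have "y (i, j', Suc t) \<le> g"
            unfolding g_def using j' Suc.prems leaders_subset by (intro gain_ge) auto
          then have "y (i, j', Suc t) = g" using g \<open>g \<noteq> a\<close> y[of "(i, j', Suc t)"] ab by auto
          then show False using i j' Suc.prems by (auto simp: g_def)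
        qed
        then show ?thesis
          using X Y Z False ab \<open>g = a \<or> g = b\<close>
          by (auto simp del: leaders.simps simp: level_Suc g_def[symmetric] split: if_splits)
      qed
    qed
    then show ?case using N by (auto simp del: leaders.simps)
  qed (auto simp: level_def x0)
  show ?thesis
    unfolding front_max_def using N
  proof (intro Max.boundedI, goal_cases)
    case (3 x)
    then obtain i where "i \<in> {1..N}" "x = front_proc N x0 xi t i" by auto
    then show ?case using *[of i] ab by (auto split: if_splits)
  qed auto
qed

section \<open>Locality in time and measurability of the leader set\<close>

lemma leaders_cong:
  assumes "\<And>e. e \<in> {1..N} \<times> {1..N} \<times> {1..t} \<Longrightarrow> y e = y' e"
  shows "leaders N y t = leaders N y' t"
  using assms
proof (induction t)
  case (Suc t)
  have IH: "leaders N y t = leaders N y' t"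
    using Suc by (intro Suc.IH Suc.prems) auto
  have *: "e \<in> {1..N} \<times> leaders N y' t \<times> {Suc t} \<Longrightarrow> y e = y' e" for e
    using leaders_subset[of N y' t] by (intro Suc.prems) auto
  then have "gain N y (Suc t) (leaders N y' t) = gain N y' (Suc t) (leaders N y' t)"
    unfolding gain_def by (intro arg_cong[where f=Max] image_cong) auto
  then show ?case using * IH by auto
qed auto

lemma measurable_gain:
  assumes "finite S" "{1..N} \<times> S \<times> {t} \<subseteq> K"
  shows "(\<lambda>y. gain N y t S) \<in> borel_measurable (PiM K (\<lambda>_. borel))"
  unfolding gain_def using assms
  by (intro borel_measurable_Max measurable_component_singleton) auto

lemma measurable_Collect_finite:
  assumes A: "finite A" and P: "\<And>i. i \<in> A \<Longrightarrow> Measurable.pred M (P i)"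
  shows "(\<lambda>x. {i \<in> A. P i x}) \<in> measurable M (count_space (Pow A))"
proof -
  have "(\<lambda>x. {i \<in> A. P i x}) -` {T} \<inter> space M \<in> sets M" if T: "T \<subseteq> A" for T
  proof -
    have "(\<lambda>x. {i \<in> A. P i x}) -` {T} \<inter> space M = {x \<in> space M. \<forall>i\<in>A. P i x \<longleftrightarrow> i \<in> T}"
      using T by auto
    also have "\<dots> \<in> sets M"
      using A P by (intro sets.sets_Collect_finite_All' pred_intros_logic predE) auto
    finally show ?thesis .
  qed
  then show ?thesis using A by (auto simp: measurable_count_space_eq2)
qed

lemma measurable_leaders:
  assumes "{1..N} \<times> {1..N} \<times> {1..t} \<subseteq> K"
  shows "(\<lambda>y. leaders N y t) \<in> measurable (PiM K (\<lambda>_. borel)) (count_space (Pow {1..N}))"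
  using assms
proof (induction t)
  case (Suc t)
  \<comment> \<open>The previous leader set is frozen to a fixed S, where the update is visibly
    measurable; the finitely many possible S are then glued together.\<close>
  let ?f = "\<lambda>S y. {i \<in> {1..N}. \<exists>j\<in>S. y (i, j, Suc t) = gain N y (Suc t) S}"
  have IH: "(\<lambda>y. leaders N y t) \<in> measurable (PiM K (\<lambda>_. borel)) (count_space (Pow {1..N}))"
    using Suc by (intro Suc.IH) (auto simp: subset_iff)
  have f: "?f S \<in> measurable (PiM K (\<lambda>_. borel)) (count_space (Pow {1..N}))" if "S \<subseteq> {1..N}" for S
  proof (rule measurable_Collect_finite)
    fix i assume i: "i \<in> {1..N}"
    have S: "finite S" using that finite_subset by blast
    have g: "(\<lambda>y. gain N y (Suc t) S) \<in> borel_measurable (PiM K (\<lambda>_. borel))"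
      using S that Suc.prems by (intro measurable_gain) (auto simp: subset_iff)
    have "Measurable.pred (PiM K (\<lambda>_. borel)) (\<lambda>y. y (i, j, Suc t) = gain N y (Suc t) S)"
      if "j \<in> S" for j
    proof -
      have "(i, j, Suc t) \<in> K" using i that \<open>S \<subseteq> _\<close> Suc.prems by auto
      then have y: "(\<lambda>y. y (i, j, Suc t)) \<in> borel_measurable (PiM K (\<lambda>_. borel :: real measure))"
        by (rule measurable_component_singleton)
      show ?thesis unfolding pred_def by (rule borel_measurable_eq[OF y g])
    qed
    then show "Measurable.pred (PiM K (\<lambda>_. borel)) (\<lambda>y. \<exists>j\<in>S. y (i, j, Suc t) = gain N y (Suc t) S)"
      using S by (intro pred_intros_finite) auto
  qed simp
  have "(\<lambda>y. ?f (leaders N y t) y) \<in> measurable (PiM K (\<lambda>_. borel)) (count_space (Pow {1..N}))"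
    by (rule measurable_compose_countable'[where f="?f", OF _ IH])
      (blast intro: f, simp add: countable_finite)
  then show ?case by simp
qed auto

section \<open>Moments of the number of leaders\<close>

text \<open>Covers both roundings of the weights. \<open>Y_cases\<close> is demanded everywhere
  rather than almost surely; rounding achieves this, and exceptional null sets matter only when
  rounded and original weights are compared.\<close>

locale greedy_front = prob_space +
  fixes N :: nat and Y :: "nat \<times> nat \<times> nat \<Rightarrow> 'a \<Rightarrow> real" and a b q :: real
  assumes N: "1 \<le> N" and q: "0 < q" "q < 1"
    and indep: "indep_vars (\<lambda>_. borel) Y ({1..N} \<times> {1..N} \<times> {1..})"
    and integrable: "\<And>e. e \<in> {1..N} \<times> {1..N} \<times> {1..} \<Longrightarrow> integrable M (Y e)"
    and ba: "b < a" and Y_cases: "\<And>e \<omega>. Y e \<omega> = a \<or> Y e \<omega> \<le> b"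
    and prob_low: "\<And>e. e \<in> {1..N} \<times> {1..N} \<times> {1..} \<Longrightarrow> prob {\<omega> \<in> space M. Y e \<omega> \<le> b} = q"
begin

abbreviation G :: "nat \<Rightarrow> 'a \<Rightarrow> nat set" where
  "G t \<omega> \<equiv> leaders N (\<lambda>e. Y e \<omega>) t"

lemma Y_measurable: "e \<in> {1..N} \<times> {1..N} \<times> {1..} \<Longrightarrow> Y e \<in> borel_measurable M"
  using indep unfolding indep_vars_def by blast

lemma G_mem: "G t \<omega> \<in> Pow {1..N} - {{}}"
  using leaders_subset leaders_nonempty[OF N] by auto

lemma G_measurable: "G t \<in> measurable M (count_space (Pow {1..N}))"
proof -
  have "(\<lambda>\<omega>. \<lambda>e\<in>{1..N} \<times> {1..N} \<times> {1..t}. Y e \<omega>)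
      \<in> measurable M (PiM ({1..N} \<times> {1..N} \<times> {1..t}) (\<lambda>_. borel))"
    by (intro measurable_restrict Y_measurable) auto
  then have "(\<lambda>\<omega>. leaders N (\<lambda>e\<in>{1..N} \<times> {1..N} \<times> {1..t}. Y e \<omega>) t)
      \<in> measurable M (count_space (Pow {1..N}))"
    by (rule measurable_compose[OF _ measurable_leaders]) simp
  also have "(\<lambda>\<omega>. leaders N (\<lambda>e\<in>{1..N} \<times> {1..N} \<times> {1..t}. Y e \<omega>) t) = G t"
    by (intro ext leaders_cong) auto
  finally show ?thesis .
qed

lemma integrable_function_G:
  fixes f :: "nat set \<Rightarrow> real"
  shows "integrable M (\<lambda>\<omega>. f (G t \<omega>))"
proof (rule integrable_const_bound)
  show "AE \<omega> in M. norm (f (G t \<omega>)) \<le> (\<Sum>S\<in>Pow {1..N}. \<bar>f S\<bar>)"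
    using G_mem by (intro AE_I2) (auto intro!: member_le_sum)
  have "f \<in> borel_measurable (count_space (Pow {1..N}))" by simp
  then show "(\<lambda>\<omega>. f (G t \<omega>)) \<in> borel_measurable M"
    by (rule measurable_compose[OF G_measurable])
qed

text \<open>Markov property. The leader set at time t is a function of the weights up to t, while
  \<open>h S\<close> sees only the slice t + 1. Splitting over the finitely many values S of the
  leader set gives products of independent factors.\<close>

lemma leaders_step:
  fixes h :: "nat set \<Rightarrow> (nat \<times> nat \<times> nat \<Rightarrow> real) \<Rightarrow> real"
  assumes meas: "\<And>S. S \<in> Pow {1..N} - {{}} \<Longrightarrow>
      h S \<in> borel_measurable (PiM ({1..N} \<times> {1..N} \<times> {Suc t}) (\<lambda>_. borel))"
    and local: "\<And>S y. S \<in> Pow {1..N} - {{}} \<Longrightarrow>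
      h S (restrict y ({1..N} \<times> {1..N} \<times> {Suc t})) = h S y"
    and int: "\<And>S. S \<in> Pow {1..N} - {{}} \<Longrightarrow> integrable M (\<lambda>\<omega>. h S (\<lambda>e. Y e \<omega>))"
  shows integrable_step: "integrable M (\<lambda>\<omega>. h (G t \<omega>) (\<lambda>e. Y e \<omega>))"
    and expectation_step: "expectation (\<lambda>\<omega>. h (G t \<omega>) (\<lambda>e. Y e \<omega>))
      = expectation (\<lambda>\<omega>. expectation (\<lambda>\<omega>'. h (G t \<omega>) (\<lambda>e. Y e \<omega>')))"
proof -
  let ?\<S> = "Pow {1..N} - {{}}" and ?I = "{1..N} \<times> {1..N} \<times> {1..t}"
    and ?J = "{1..N} \<times> {1..N} \<times> {Suc t}"
  have decomp: "f (G t \<omega>) = (\<Sum>S\<in>?\<S>. indicat_real {S} (G t \<omega>) * f S)"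
    for f :: "nat set \<Rightarrow> real" and \<omega>
  proof -
    have "(\<Sum>S\<in>?\<S>. indicat_real {S} (G t \<omega>) * f S) = (\<Sum>S\<in>?\<S>. if S = G t \<omega> then f S else 0)"
      by (intro sum.cong) (auto simp: indicator_def)
    also have "\<dots> = f (G t \<omega>)" using G_mem[of \<omega> t] by (subst sum.delta) auto
    finally show ?thesis by simp
  qed
  have ind: "indep_var borel (\<lambda>\<omega>. indicat_real {S} (G t \<omega>) :: real) borel (\<lambda>\<omega>. h S (\<lambda>e. Y e \<omega>))"
    if S: "S \<in> ?\<S>" for S
  proof -
    have "indep_var (PiM ?I (\<lambda>_. borel)) (\<lambda>\<omega>. \<lambda>e\<in>?I. Y e \<omega>) (PiM ?J (\<lambda>_. borel)) (\<lambda>\<omega>. \<lambda>e\<in>?J. Y e \<omega>)"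
      using indep by (rule indep_var_restrict) auto
    moreover have "(\<lambda>y. indicator {S} (leaders N y t) :: real) \<in> borel_measurable (PiM ?I (\<lambda>_. borel))"
    proof (rule measurable_compose[OF measurable_leaders[OF order_refl]])
      show "(indicator {S} :: _ \<Rightarrow> real) \<in> borel_measurable (count_space (Pow {1..N}))" by simp
    qed
    ultimately have "indep_var borel ((\<lambda>y. indicator {S} (leaders N y t) :: real) \<circ> (\<lambda>\<omega>. \<lambda>e\<in>?I. Y e \<omega>))
        borel (h S \<circ> (\<lambda>\<omega>. \<lambda>e\<in>?J. Y e \<omega>))"
      using meas[OF S] by (rule indep_var_compose)
    moreover have "leaders N (\<lambda>e\<in>?I. Y e \<omega>) t = G t \<omega>" for \<omega>
      by (intro leaders_cong) auto
    ultimately show ?thesis using local[OF S] by (simp add: comp_def)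
  qed
  have intI: "integrable M (\<lambda>\<omega>. indicat_real {S} (G t \<omega>) :: real)" for S
    by (rule integrable_function_G)
  note intS = indep_var_integrable[OF ind intI int]
  note expS = indep_var_lebesgue_integral[OF ind intI int]
  have D: "(\<lambda>\<omega>. h (G t \<omega>) (\<lambda>e. Y e \<omega>))
      = (\<lambda>\<omega>. \<Sum>S\<in>?\<S>. indicat_real {S} (G t \<omega>) * h S (\<lambda>e. Y e \<omega>))"
    by (intro ext) (rule decomp)
  have E: "(\<lambda>\<omega>. expectation (\<lambda>\<omega>'. h (G t \<omega>) (\<lambda>e. Y e \<omega>')))
      = (\<lambda>\<omega>. \<Sum>S\<in>?\<S>. indicat_real {S} (G t \<omega>) * expectation (\<lambda>\<omega>'. h S (\<lambda>e. Y e \<omega>')))"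
    by (intro ext) (rule decomp)
  show "integrable M (\<lambda>\<omega>. h (G t \<omega>) (\<lambda>e. Y e \<omega>))"
    unfolding D using intS by (intro Bochner_Integration.integrable_sum)
  have "expectation (\<lambda>\<omega>. h (G t \<omega>) (\<lambda>e. Y e \<omega>))
      = expectation (\<lambda>\<omega>. \<Sum>S\<in>?\<S>. indicat_real {S} (G t \<omega>) * h S (\<lambda>e. Y e \<omega>))"
    unfolding D ..
  also have "\<dots> = (\<Sum>S\<in>?\<S>. expectation (\<lambda>\<omega>. indicat_real {S} (G t \<omega>) * h S (\<lambda>e. Y e \<omega>)))"
    using intS by (intro Bochner_Integration.integral_sum) auto
  also have "\<dots> = (\<Sum>S\<in>?\<S>. expectation (\<lambda>\<omega>. indicat_real {S} (G t \<omega>))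
      * expectation (\<lambda>\<omega>. h S (\<lambda>e. Y e \<omega>)))"
    using expS by (intro sum.cong) auto
  also have "\<dots> = (\<Sum>S\<in>?\<S>. expectation (\<lambda>\<omega>. indicat_real {S} (G t \<omega>)
      * expectation (\<lambda>\<omega>. h S (\<lambda>e. Y e \<omega>))))"
    by simp
  also have "\<dots> = expectation (\<lambda>\<omega>. \<Sum>S\<in>?\<S>. indicat_real {S} (G t \<omega>)
      * expectation (\<lambda>\<omega>. h S (\<lambda>e. Y e \<omega>)))"
    using intI by (intro Bochner_Integration.integral_sum[symmetric]) auto
  also have "\<dots> = expectation (\<lambda>\<omega>. expectation (\<lambda>\<omega>'. h (G t \<omega>) (\<lambda>e. Y e \<omega>')))"
    unfolding E ..
  finally show "expectation (\<lambda>\<omega>. h (G t \<omega>) (\<lambda>e. Y e \<omega>))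
      = expectation (\<lambda>\<omega>. expectation (\<lambda>\<omega>'. h (G t \<omega>) (\<lambda>e. Y e \<omega>')))" .
qed

section \<open>Expectations of products over edges\<close>

lemma prod_functions:
  fixes f :: "nat \<times> nat \<times> nat \<Rightarrow> real \<Rightarrow> real"
  assumes E: "finite E" "E \<subseteq> {1..N} \<times> {1..N} \<times> {1..}"
    and f: "\<And>e. e \<in> E \<Longrightarrow> f e \<in> borel_measurable borel"
    and int: "\<And>e. e \<in> E \<Longrightarrow> integrable M (\<lambda>\<omega>. f e (Y e \<omega>))"
  shows integrable_prod: "integrable M (\<lambda>\<omega>. \<Prod>e\<in>E. f e (Y e \<omega>))"
    and expectation_prod: "expectation (\<lambda>\<omega>. \<Prod>e\<in>E. f e (Y e \<omega>)) = (\<Prod>e\<in>E. expectation (\<lambda>\<omega>. f e (Y e \<omega>)))"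
proof -
  have "indep_vars (\<lambda>_. borel) (\<lambda>e \<omega>. f e (Y e \<omega>)) E"
    using indep_vars_subset[OF indep E(2)] f by (rule indep_vars_compose2)
  then show "integrable M (\<lambda>\<omega>. \<Prod>e\<in>E. f e (Y e \<omega>))"
    "expectation (\<lambda>\<omega>. \<Prod>e\<in>E. f e (Y e \<omega>)) = (\<Prod>e\<in>E. expectation (\<lambda>\<omega>. f e (Y e \<omega>)))"
    using indep_vars_integrable[OF E(1) _ int] indep_vars_lebesgue_integral[OF E(1) _ int] by auto
qed

lemma indicator_threshold:
  assumes e: "e \<in> {1..N} \<times> {1..N} \<times> {1..}"
  shows integrable_indicator_threshold: "integrable M (\<lambda>\<omega>. indicat_real {..c} (Y e \<omega>) :: real)"
    and expectation_indicator_threshold: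
      "expectation (\<lambda>\<omega>. indicat_real {..c} (Y e \<omega>)) = prob {\<omega> \<in> space M. Y e \<omega> \<le> c}"
proof -
  have [measurable]: "Y e \<in> borel_measurable M" using e by (rule Y_measurable)
  show "integrable M (\<lambda>\<omega>. indicat_real {..c} (Y e \<omega>) :: real)"
    by (rule integrable_const_bound[where B=1]) (auto simp: indicator_def)
  have "expectation (\<lambda>\<omega>. indicat_real {..c} (Y e \<omega>))
      = expectation (indicator {\<omega> \<in> space M. Y e \<omega> \<le> c} :: _ \<Rightarrow> real)"
    by (intro Bochner_Integration.integral_cong) (auto simp: indicator_def)
  then show "expectation (\<lambda>\<omega>. indicat_real {..c} (Y e \<omega>)) = prob {\<omega> \<in> space M. Y e \<omega> \<le> c}"
    by simp
qed

lemma all_low: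
  assumes E: "finite E" "E \<subseteq> {1..N} \<times> {1..N} \<times> {1..}"
  shows integrable_all_low: "integrable M (\<lambda>\<omega>. \<Prod>e\<in>E. indicat_real {..b} (Y e \<omega>) :: real)"
    and expectation_all_low: "expectation (\<lambda>\<omega>. \<Prod>e\<in>E. indicat_real {..b} (Y e \<omega>)) = q ^ card E"
proof -
  show "integrable M (\<lambda>\<omega>. \<Prod>e\<in>E. indicat_real {..b} (Y e \<omega>) :: real)"
    using E by (intro integrable_prod[where f="\<lambda>_. indicat_real {..b}"] integrable_indicator_threshold) auto
  have "expectation (\<lambda>\<omega>. \<Prod>e\<in>E. indicat_real {..b} (Y e \<omega>))
      = (\<Prod>e\<in>E. expectation (\<lambda>\<omega>. indicat_real {..b} (Y e \<omega>)))"
    using E by (intro expectation_prod[where f="\<lambda>_. indicat_real {..b}"] integrable_indicator_threshold) auto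
  also have "\<dots> = (\<Prod>e\<in>E. q)"
    using E by (intro prod.cong refl) (auto simp only: expectation_indicator_threshold prob_low subset_eq)
  finally show "expectation (\<lambda>\<omega>. \<Prod>e\<in>E. indicat_real {..b} (Y e \<omega>)) = q ^ card E" by simp
qed

end

text \<open>Unlike the leader set, this set may be empty, and exactly then the front fails to
  advance by \<open>a\<close>. Allowing emptiness makes its cardinality exactly binomial when the
  weights are independent; when nonempty it is the next leader set.\<close>

definition hits :: "nat \<Rightarrow> real \<Rightarrow> (nat \<times> nat \<times> nat \<Rightarrow> real) \<Rightarrow> nat \<Rightarrow> nat set \<Rightarrow> nat set" where
  "hits N b y t S = {i \<in> {1..N}. \<exists>j\<in>S. b < y (i, j, t)}"

lemma prod_indicator_atMost:
  fixes y :: "'e \<Rightarrow> real"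
  assumes "finite E"
  shows "(\<Prod>e\<in>E. indicat_real {..b} (y e)) = (if \<exists>e\<in>E. b < y e then 0 else 1)"
proof (cases "\<exists>e\<in>E. b < y e")
  case True
  then obtain e where "e \<in> E" "b < y e" by blast
  then have "\<exists>e\<in>E. indicat_real {..b} (y e) = 0"
    by (intro bexI[of _ e]) (simp_all add: indicator_def not_le)
  then show ?thesis using True assms by (simp add: prod_zero)
next
  case False
  then have "\<And>e. e \<in> E \<Longrightarrow> indicat_real {..b} (y e) = 1" by (force simp: indicator_def)
  then show ?thesis using False by (simp add: prod.neutral)
qed

text \<open>The factor of i is x if i is hit and 1 otherwise. Written this way, the power is a
  polynomial in indicators of single edges, to which independence applies.\<close>

lemma power_card_hits:
  assumes "finite S"
  shows "x ^ card (hits N b y t S)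
    = (\<Prod>i\<in>{1..N}. (1 - x) * (\<Prod>j\<in>S. indicat_real {..b} (y (i, j, t))) + x)"
proof -
  have "(\<Prod>i\<in>{1..N}. (1 - x) * (\<Prod>j\<in>S. indicat_real {..b} (y (i, j, t))) + x)
      = (\<Prod>i\<in>{1..N}. if i \<in> hits N b y t S then x else 1)"
  proof (rule prod.cong)
    fix i assume "i \<in> {1..N}"
    then show "(1 - x) * (\<Prod>j\<in>S. indicat_real {..b} (y (i, j, t))) + x
        = (if i \<in> hits N b y t S then x else 1)"
      using prod_indicator_atMost[OF assms, of b "\<lambda>j. y (i, j, t)"] by (simp add: hits_def)
  qed simp
  also have "\<dots> = x ^ card ({1..N} \<inter> {i. i \<in> hits N b y t S})"
    by (subst prod.If_cases) auto
  also have "{1..N} \<inter> {i. i \<in> hits N b y t S} = hits N b y t S" by (auto simp: hits_def)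
  finally show ?thesis ..
qed

lemma prod_indicator_eq_hits_empty:
  assumes "finite S"
  shows "(\<Prod>e\<in>{1..N} \<times> S \<times> {t}. indicat_real {..b} (y e)) = (if hits N b y t S = {} then 1 else 0)"
  using assms by (subst prod_indicator_atMost) (auto simp: hits_def)

lemma gain_eq_of_hits:
  assumes S: "S \<subseteq> {1..N}" and y: "\<And>e. y e = a \<or> y e \<le> b" and ba: "b < a"
    and hits: "hits N b y t S \<noteq> {}"
  shows "gain N y t S = a"
proof (rule antisym)
  obtain i j where ij: "i \<in> {1..N}" "j \<in> S" "b < y (i, j, t)" using hits by (auto simp: hits_def)
  then have "y (i, j, t) = a" using y[of "(i, j, t)"] by auto
  then show "a \<le> gain N y t S" using gain_ge[OF ij(1,2) S, of y t] by simp
  have "y e \<le> a" for e using y[of e] ba by auto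
  then show "gain N y t S \<le> a"
    unfolding gain_def using ij finite_subset[OF S] by (intro Max.boundedI) auto
qed

lemma argmax_eq_hits:
  assumes S: "S \<subseteq> {1..N}" and y: "\<And>e. y e = a \<or> y e \<le> b" and ba: "b < a"
    and hits: "hits N b y t S \<noteq> {}"
  shows "{i \<in> {1..N}. \<exists>j\<in>S. y (i, j, t) = gain N y t S} = hits N b y t S"
  unfolding gain_eq_of_hits[OF assms] unfolding hits_def using y ba by force

context greedy_front
begin

text \<open>The generating function of a binomial variable with parameters N and 1 - q^|S|: distinct
  targets i use disjoint sets of edges.\<close>

lemma power_hits:
  assumes S: "S \<subseteq> {1..N}" and t: "1 \<le> t"
  shows integrable_power_hits: "integrable M (\<lambda>\<omega>. x ^ card (hits N b (\<lambda>e. Y e \<omega>) t S))"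
    and expectation_power_hits: "expectation (\<lambda>\<omega>. x ^ card (hits N b (\<lambda>e. Y e \<omega>) t S))
      = (q ^ card S + (1 - q ^ card S) * x) ^ N"
proof -
  have fin: "finite S" using S finite_subset by blast
  \<comment> \<open>Expanding the product over i into a sum over subsets U leaves one product of
    edge indicators per term, with expectation q^(|S| |U|); the sum is folded back into a product
    afterwards.\<close>
  let ?f = "\<lambda>U \<omega>. (1 - x) ^ card U * x ^ card ({1..N} - U)
      * (\<Prod>e\<in>U \<times> S \<times> {t}. indicat_real {..b} (Y e \<omega>))"
  have eq: "x ^ card (hits N b (\<lambda>e. Y e \<omega>) t S) = (\<Sum>U\<in>Pow {1..N}. ?f U \<omega>)" for \<omega>
  proof -
    have "(\<Prod>i\<in>U. \<Prod>j\<in>S. indicat_real {..b} (Y (i, j, t) \<omega>))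
        = (\<Prod>e\<in>U \<times> S \<times> {t}. indicat_real {..b} (Y e \<omega>))" for U
      by (simp add: prod.cartesian_product')
    then show ?thesis
      unfolding power_card_hits[OF fin] by (subst prod_add) (auto simp: prod.distrib mult_ac intro!: sum.cong)
  qed
  have sub: "U \<times> S \<times> {t} \<subseteq> {1..N} \<times> {1..N} \<times> {1..}" "finite (U \<times> S \<times> {t})"
    if "U \<in> Pow {1..N}" for U
    using that S t fin finite_subset[of U "{1..N}"] by auto
  have int: "integrable M (?f U)" if "U \<in> Pow {1..N}" for U
    using integrable_all_low[OF sub(2,1)[OF that]] by simp
  show "integrable M (\<lambda>\<omega>. x ^ card (hits N b (\<lambda>e. Y e \<omega>) t S))"
    unfolding eq using int by (intro Bochner_Integration.integrable_sum)
  have "expectation (\<lambda>\<omega>. x ^ card (hits N b (\<lambda>e. Y e \<omega>) t S))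
      = (\<Sum>U\<in>Pow {1..N}. expectation (?f U))"
    unfolding eq using int by (intro Bochner_Integration.integral_sum)
  also have "\<dots> = (\<Sum>U\<in>Pow {1..N}. (\<Prod>i\<in>U. (1 - x) * q ^ card S) * (\<Prod>i\<in>{1..N} - U. x))"
  proof (rule sum.cong)
    fix U assume U: "U \<in> Pow {1..N}"
    have "card (U \<times> S \<times> {t}) = card S * card U" by (simp add: card_cartesian_product)
    then show "expectation (?f U) = (\<Prod>i\<in>U. (1 - x) * q ^ card S) * (\<Prod>i\<in>{1..N} - U. x)"
      using expectation_all_low[OF sub(2,1)[OF U]] by (simp add: power_mult_distrib power_mult)
  qed simp
  also have "\<dots> = (\<Prod>i\<in>{1..N}. (1 - x) * q ^ card S + x)"
    by (rule prod_add[symmetric]) simp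
  also have "\<dots> = (q ^ card S + (1 - q ^ card S) * x) ^ N"
    by (simp add: algebra_simps)
  finally show "expectation (\<lambda>\<omega>. x ^ card (hits N b (\<lambda>e. Y e \<omega>) t S))
      = (q ^ card S + (1 - q ^ card S) * x) ^ N" .
qed

lemma all_low_from_leaders:
  assumes S: "S \<subseteq> {1..N}" and t: "1 \<le> t"
  shows integrable_fail: "integrable M (\<lambda>\<omega>. \<Prod>e\<in>{1..N} \<times> S \<times> {t}. indicat_real {..b} (Y e \<omega>))"
    and expectation_fail: "expectation (\<lambda>\<omega>. \<Prod>e\<in>{1..N} \<times> S \<times> {t}. indicat_real {..b} (Y e \<omega>))
      = q ^ (N * card S)"
proof -
  have E: "finite ({1..N} \<times> S \<times> {t})" "{1..N} \<times> S \<times> {t} \<subseteq> {1..N} \<times> {1..N} \<times> {1..}"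
    using S t finite_subset[OF S] by auto
  show "integrable M (\<lambda>\<omega>. \<Prod>e\<in>{1..N} \<times> S \<times> {t}. indicat_real {..b} (Y e \<omega>))"
    by (rule integrable_all_low[OF E])
  show "expectation (\<lambda>\<omega>. \<Prod>e\<in>{1..N} \<times> S \<times> {t}. indicat_real {..b} (Y e \<omega>)) = q ^ (N * card S)"
    unfolding expectation_all_low[OF E] by (simp add: card_cartesian_product)
qed

text \<open>The factor \<open>c\<close> stays free because on failure the empty set of hits
  contributes x^0 = 1, which the two moment bounds correct differently: by -1 from below and by
  \<open>q ^ m - 1\<close> from above.\<close>

lemma hits_fail_step:
  shows integrable_hits_fail_step: "integrable M (\<lambda>\<omega>. x ^ card (hits N b (\<lambda>e. Y e \<omega>) (Suc t) (G t \<omega>))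
      + c * (\<Prod>e\<in>{1..N} \<times> G t \<omega> \<times> {Suc t}. indicat_real {..b} (Y e \<omega>)))"
    and expectation_hits_fail_step:
    "expectation (\<lambda>\<omega>. x ^ card (hits N b (\<lambda>e. Y e \<omega>) (Suc t) (G t \<omega>))
      + c * (\<Prod>e\<in>{1..N} \<times> G t \<omega> \<times> {Suc t}. indicat_real {..b} (Y e \<omega>)))
    = expectation (\<lambda>\<omega>. (q ^ card (G t \<omega>) + (1 - q ^ card (G t \<omega>)) * x) ^ N
      + c * q ^ (N * card (G t \<omega>)))"
proof -
  define h where "h S y = x ^ card (hits N b y (Suc t) S)
      + c * (\<Prod>e\<in>{1..N} \<times> S \<times> {Suc t}. indicat_real {..b} (y e))" for S y
  have meas: "h S \<in> borel_measurable (PiM ({1..N} \<times> {1..N} \<times> {Suc t}) (\<lambda>_. borel))"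
    if "S \<in> Pow {1..N} - {{}}" for S
  proof -
    have fin: "finite S" using that finite_subset by auto
    have ind: "(\<lambda>y. indicat_real {..b} (y e)) \<in> borel_measurable (PiM ({1..N} \<times> {1..N} \<times> {Suc t}) (\<lambda>_. borel))"
      if "e \<in> {1..N} \<times> {1..N} \<times> {Suc t}" for e
      using that by (intro measurable_compose[OF measurable_component_singleton]) auto
    show ?thesis
      unfolding h_def power_card_hits[OF fin] using that
      by (intro borel_measurable_add borel_measurable_prod borel_measurable_times ind
            borel_measurable_const) auto
  qed
  have local: "h S (restrict y ({1..N} \<times> {1..N} \<times> {Suc t})) = h S y"
    if "S \<in> Pow {1..N} - {{}}" for S y
  proof -
    have "hits N b (restrict y ({1..N} \<times> {1..N} \<times> {Suc t})) (Suc t) S = hits N b y (Suc t) S"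
      unfolding hits_def using that by (intro Collect_cong conj_cong bex_cong refl) auto
    moreover have "(\<Prod>e\<in>{1..N} \<times> S \<times> {Suc t}. indicat_real {..b} (restrict y ({1..N} \<times> {1..N} \<times> {Suc t}) e))
        = (\<Prod>e\<in>{1..N} \<times> S \<times> {Suc t}. indicat_real {..b} (y e))"
      using that by (intro prod.cong refl) auto
    ultimately show ?thesis unfolding h_def by simp
  qed
  have int: "integrable M (\<lambda>\<omega>. h S (\<lambda>e. Y e \<omega>))"
    and exp: "expectation (\<lambda>\<omega>. h S (\<lambda>e. Y e \<omega>))
      = (q ^ card S + (1 - q ^ card S) * x) ^ N + c * q ^ (N * card S)"
    if "S \<in> Pow {1..N} - {{}}" for S
  proof -
    have S: "S \<subseteq> {1..N}" using that by auto
    have t: "1 \<le> Suc t" by simp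
    show "integrable M (\<lambda>\<omega>. h S (\<lambda>e. Y e \<omega>))"
      unfolding h_def
      by (intro Bochner_Integration.integrable_add integrable_mult_right
          integrable_power_hits[OF S t] integrable_fail[OF S t])
    have "expectation (\<lambda>\<omega>. h S (\<lambda>e. Y e \<omega>)) = expectation (\<lambda>\<omega>. x ^ card (hits N b (\<lambda>e. Y e \<omega>) (Suc t) S))
        + expectation (\<lambda>\<omega>. c * (\<Prod>e\<in>{1..N} \<times> S \<times> {Suc t}. indicat_real {..b} (Y e \<omega>)))"
      unfolding h_def
      by (intro Bochner_Integration.integral_add integrable_mult_right
          integrable_power_hits[OF S t] integrable_fail[OF S t])
    then show "expectation (\<lambda>\<omega>. h S (\<lambda>e. Y e \<omega>))
      = (q ^ card S + (1 - q ^ card S) * x) ^ N + c * q ^ (N * card S)"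
      by (simp only: integral_mult_right_zero expectation_power_hits[OF S t] expectation_fail[OF S t])
  qed
  show "integrable M (\<lambda>\<omega>. x ^ card (hits N b (\<lambda>e. Y e \<omega>) (Suc t) (G t \<omega>))
      + c * (\<Prod>e\<in>{1..N} \<times> G t \<omega> \<times> {Suc t}. indicat_real {..b} (Y e \<omega>)))"
    using integrable_step[of h, OF meas local int] by (simp only: h_def)
  have "expectation (\<lambda>\<omega>. h (G t \<omega>) (\<lambda>e. Y e \<omega>)) =
      expectation (\<lambda>\<omega>. expectation (\<lambda>\<omega>'. h (G t \<omega>) (\<lambda>e. Y e \<omega>')))"
    by (rule expectation_step[of h, OF meas local int])
  also have "\<dots> = expectation (\<lambda>\<omega>. (q ^ card (G t \<omega>) + (1 - q ^ card (G t \<omega>)) * x) ^ N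
      + c * q ^ (N * card (G t \<omega>)))"
    by (simp only: exp[OF G_mem])
  finally show "expectation (\<lambda>\<omega>. x ^ card (hits N b (\<lambda>e. Y e \<omega>) (Suc t) (G t \<omega>))
      + c * (\<Prod>e\<in>{1..N} \<times> G t \<omega> \<times> {Suc t}. indicat_real {..b} (Y e \<omega>)))
    = expectation (\<lambda>\<omega>. (q ^ card (G t \<omega>) + (1 - q ^ card (G t \<omega>)) * x) ^ N
      + c * q ^ (N * card (G t \<omega>)))"
    by (simp only: h_def)
qed

text \<open>\<open>u N t\<close> is the probability that the front fails to advance by \<open>a\<close> at time \<open>t + 1\<close>.\<close>

definition u :: "nat \<Rightarrow> nat \<Rightarrow> real" where
  "u m t = expectation (\<lambda>\<omega>. q ^ (m * card (G t \<omega>)))"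

lemma u_eq: "u m t = expectation (\<lambda>\<omega>. (q ^ m) ^ card (G t \<omega>))"
  by (simp add: u_def power_mult)

section \<open>Moment inequalities over one time step\<close>

lemma leaders_Suc_hits:
  assumes "hits N b (\<lambda>e. Y e \<omega>) (Suc t) (G t \<omega>) \<noteq> {}"
  shows "G (Suc t) \<omega> = hits N b (\<lambda>e. Y e \<omega>) (Suc t) (G t \<omega>)"
  unfolding leaders.simps using argmax_eq_hits[OF leaders_subset Y_cases ba assms] .

lemma fail_eq:
  "(\<Prod>e\<in>{1..N} \<times> G t \<omega> \<times> {Suc t}. indicat_real {..b} (Y e \<omega>))
    = (if hits N b (\<lambda>e. Y e \<omega>) (Suc t) (G t \<omega>) = {} then 1 else 0)"
  using prod_indicator_eq_hits_empty[OF finite_subset[OF leaders_subset finite_atLeastAtMost]] .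

text \<open>Without failure the leaders are the hits. On failure the spurious 1 is replaced by 0,
  which is below any power of q.\<close>

lemma u_Suc_ge:
  "expectation (\<lambda>\<omega>. (q ^ card (G t \<omega>) + (1 - q ^ card (G t \<omega>)) * q ^ m) ^ N
      + - 1 * q ^ (N * card (G t \<omega>))) \<le> u m (Suc t)"
  unfolding expectation_hits_fail_step[symmetric] u_eq
proof (rule integral_mono[OF integrable_hits_fail_step integrable_function_G])
  fix \<omega> assume "\<omega> \<in> space M"
  show "(q ^ m) ^ card (hits N b (\<lambda>e. Y e \<omega>) (Suc t) (G t \<omega>))
      + - 1 * (\<Prod>e\<in>{1..N} \<times> G t \<omega> \<times> {Suc t}. indicat_real {..b} (Y e \<omega>))
      \<le> (q ^ m) ^ card (G (Suc t) \<omega>)"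
    using leaders_Suc_hits[of \<omega> t] q unfolding fail_eq by (simp del: leaders.simps)
qed

text \<open>On failure at least one leader remains, so the spurious 1 may be lowered to
  \<open>q ^ m\<close>. Keeping this factor is what makes the self term of the recursion
  contract.\<close>

lemma u_Suc_le:
  "u m (Suc t) \<le> expectation (\<lambda>\<omega>. (q ^ card (G t \<omega>) + (1 - q ^ card (G t \<omega>)) * q ^ m) ^ N
      + (q ^ m - 1) * q ^ (N * card (G t \<omega>)))"
  unfolding expectation_hits_fail_step[symmetric] u_eq
proof (rule integral_mono[OF integrable_function_G integrable_hits_fail_step])
  fix \<omega> assume "\<omega> \<in> space M"
  have "0 < card (G (Suc t) \<omega>)"
    using G_mem[of \<omega> "Suc t"] finite_subset[of _ "{1..N}"] by (auto simp: card_gt_0_iff simp del: leaders.simps)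
  then have "(q ^ m) ^ card (G (Suc t) \<omega>) \<le> (q ^ m) ^ 1"
    using q by (intro power_decreasing) (auto intro: power_le_one)
  then show "(q ^ m) ^ card (G (Suc t) \<omega>) \<le> (q ^ m) ^ card (hits N b (\<lambda>e. Y e \<omega>) (Suc t) (G t \<omega>))
      + (q ^ m - 1) * (\<Prod>e\<in>{1..N} \<times> G t \<omega> \<times> {Suc t}. indicat_real {..b} (Y e \<omega>))"
    using leaders_Suc_hits[of \<omega> t] unfolding fail_eq by (simp del: leaders.simps)
qed

text \<open>With k leaders, drop 1 - q^k and expand (q^k + q^m)^N. The summand l = N is q^(N k) and
  cancels against the failure correction; what survives is q^m q^(N k), at most q^m q^(m k) because
  m \<le> N. Hence only moments of order l < N and the moment itself occur.\<close>

lemma u_recursion: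
  assumes m: "m \<le> N"
  shows "u m (Suc t) \<le> (\<Sum>l<N. real (N choose l) * (q ^ m) ^ (N - l) * u l t) + q ^ m * u m t"
proof -
  have "u m (Suc t) \<le> expectation (\<lambda>\<omega>. (q ^ card (G t \<omega>) + (1 - q ^ card (G t \<omega>)) * q ^ m) ^ N
      + (q ^ m - 1) * q ^ (N * card (G t \<omega>)))"
    by (rule u_Suc_le)
  also have "\<dots> \<le> expectation (\<lambda>\<omega>. (\<Sum>l<N. real (N choose l) * (q ^ m) ^ (N - l) * q ^ (l * card (G t \<omega>)))
      + q ^ m * q ^ (m * card (G t \<omega>)))"
  proof (rule integral_mono[OF integrable_function_G integrable_function_G])
    fix \<omega>
    define k where "k = card (G t \<omega>)"
    have qk: "0 \<le> q ^ k" "q ^ k \<le> 1" "0 \<le> q ^ m" using q by (auto intro: power_le_one)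
    have "(1 - q ^ k) * q ^ m \<le> q ^ m" using qk by (simp add: mult_left_le_one_le)
    then have "(q ^ k + (1 - q ^ k) * q ^ m) ^ N \<le> (q ^ k + q ^ m) ^ N"
      using qk by (intro power_mono add_left_mono) auto
    moreover have "(\<Sum>l<N. real (N choose l) * (q ^ m) ^ (N - l) * q ^ (l * k))
        = (q ^ k + q ^ m) ^ N - q ^ (N * k)"
      unfolding mult.commute[of _ k] power_mult binomial_sum_less[symmetric]
      by (intro sum.cong) auto
    moreover have "q ^ m * q ^ (N * k) \<le> q ^ m * q ^ (m * k)"
      using q m by (intro mult_left_mono power_decreasing) auto
    ultimately show "(q ^ card (G t \<omega>) + (1 - q ^ card (G t \<omega>)) * q ^ m) ^ N
        + (q ^ m - 1) * q ^ (N * card (G t \<omega>))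
      \<le> (\<Sum>l<N. real (N choose l) * (q ^ m) ^ (N - l) * q ^ (l * card (G t \<omega>)))
        + q ^ m * q ^ (m * card (G t \<omega>))"
      unfolding k_def[symmetric] by (simp add: algebra_simps)
  qed
  also have "\<dots> = (\<Sum>l<N. real (N choose l) * (q ^ m) ^ (N - l) * u l t) + q ^ m * u m t"
  proof -
    have i: "integrable M (\<lambda>\<omega>. c * q ^ (l * card (G t \<omega>)))" for c :: real and l
      by (rule integrable_function_G)
    have "expectation (\<lambda>\<omega>. \<Sum>l<N. real (N choose l) * (q ^ m) ^ (N - l) * q ^ (l * card (G t \<omega>)))
        = (\<Sum>l<N. expectation (\<lambda>\<omega>. real (N choose l) * (q ^ m) ^ (N - l) * q ^ (l * card (G t \<omega>))))"
      by (rule Bochner_Integration.integral_sum[OF i])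
    then show ?thesis
      unfolding u_def by (subst Bochner_Integration.integral_add[OF integrable_function_G i]) simp
  qed
  finally show ?thesis .
qed

lemma u_N_le:
  assumes y: "0 < y" and R: "0 < R" and \<eta>: "0 < \<eta>" "\<eta> \<le> (1 - q) / 2"
    and key: "\<And>s. 1 \<le> s \<Longrightarrow>
           (1 + q ^ s) ^ N - 1 + R ^ N * (y + q ^ s) ^ N \<le> \<eta> * (1 + R ^ N * y ^ s)"
  shows "u N t \<le> q ^ (N\<^sup>2) * ((2 ^ N + 2 / (1 - q) * (\<eta> * (2 ^ N + (R * (1 + y)) ^ N)
           + ((1 + q) ^ N + (R * (q + y)) ^ N))) / (1 - q ^ N))"
proof -
  \<comment> \<open>Normalised by the value of the moment when all N particles lead, which is the
    initial state; therefore \<open>w m 0 = 1\<close>. The exponent identity below turns the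
    recursion for \<open>u\<close> into the one for \<open>w\<close>.\<close>
  define w where "w m t = u m t / q ^ (m * N)" for m t
  have "w N t \<le> (2 ^ N + 2 / (1 - q) * (\<eta> * (2 ^ N + (R * (1 + y)) ^ N)
           + ((1 + q) ^ N + (R * (q + y)) ^ N))) / (1 - q ^ N)"
  proof (rule binomial_recursion_bound[OF q y R N \<eta> refl key])
    show "w 0 t = 1" for t by (simp add: w_def u_def prob_space)
    show "w m 0 = 1" for m using q by (simp add: w_def u_def prob_space)
    show "w m (Suc t) \<le> (\<Sum>l<N. real (N choose l) * (q ^ (N - m)) ^ l * w l t) + q ^ m * w m t"
      if m: "m \<le> N" for m t
    proof -
      have pow: "(q ^ m) ^ (N - l) / q ^ (m * N) = (q ^ (N - m)) ^ l / q ^ (l * N)" if l: "l < N" for l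
      proof -
        obtain d where d: "N = m + d" using le_Suc_ex[OF m] by blast
        obtain e where e: "N = l + e" using le_Suc_ex[OF less_imp_le[OF l]] by blast
        have "m * (N - l) + l * N = (N - m) * l + m * N"
        proof -
          have "m * e + l * (m + d) = d * l + m * (l + e)" by (simp add: algebra_simps)
          then show ?thesis using d e by (metis diff_add_inverse)
        qed
        then have "(q ^ m) ^ (N - l) * q ^ (l * N) = (q ^ (N - m)) ^ l * q ^ (m * N)"
          by (simp flip: power_add power_mult)
        then show ?thesis using q by (simp add: field_simps)
      qed
      have *: "(real (N choose l) * (q ^ m) ^ (N - l) * u l t) / q ^ (m * N)
          = real (N choose l) * (q ^ (N - m)) ^ l * w l t" if "l < N" for l
      proof -
        have "(real (N choose l) * (q ^ m) ^ (N - l) * u l t) / q ^ (m * N)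
            = real (N choose l) * ((q ^ m) ^ (N - l) / q ^ (m * N)) * u l t" by simp
        also have "(q ^ m) ^ (N - l) / q ^ (m * N) = (q ^ (N - m)) ^ l / q ^ (l * N)"
          using that by (rule pow)
        finally show ?thesis by (simp add: w_def)
      qed
      have "w m (Suc t) \<le> ((\<Sum>l<N. real (N choose l) * (q ^ m) ^ (N - l) * u l t) + q ^ m * u m t) / q ^ (m * N)"
        unfolding w_def using u_recursion[OF m] q by (intro divide_right_mono) auto
      also have "\<dots> = (\<Sum>l<N. (real (N choose l) * (q ^ m) ^ (N - l) * u l t) / q ^ (m * N)) + q ^ m * w m t"
        by (simp add: add_divide_distrib sum_divide_distrib w_def)
      also have "\<dots> = (\<Sum>l<N. real (N choose l) * (q ^ (N - m)) ^ l * w l t) + q ^ m * w m t"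
        using * by (intro arg_cong2[where f="(+)"] sum.cong refl) simp
      finally show ?thesis .
    qed
  qed
  then show ?thesis
    using q unfolding w_def by (simp only: pos_divide_le_eq zero_less_power power2_eq_square mult.commute)
qed

text \<open>A bound valid for every leader count k survives averaging over any law of the leader
  set. It starts at time 1: at time 0 everyone leads, and \<open>u N 0\<close> is q^(N^2) without
  the factor 2^N.\<close>

lemma u_N_Suc_ge:
  assumes "\<And>k. k \<in> {1..N} \<Longrightarrow> c \<le> (q ^ k + (1 - q ^ k) * q ^ N) ^ N - (q ^ k) ^ N"
  shows "c \<le> u N (Suc t)"
proof -
  have "c = expectation (\<lambda>\<omega>. c)" by (simp add: prob_space)
  also have "\<dots> \<le> expectation (\<lambda>\<omega>. (q ^ card (G t \<omega>) + (1 - q ^ card (G t \<omega>)) * q ^ N) ^ N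
      + - 1 * q ^ (N * card (G t \<omega>)))"
  proof (rule integral_mono[OF _ integrable_function_G])
    fix \<omega>
    have "card (G t \<omega>) \<in> {1..N}"
      using G_mem[of \<omega> t] finite_subset[of "G t \<omega>" "{1..N}"] card_mono[of "{1..N}" "G t \<omega>"]
      by (auto simp: Suc_le_eq card_gt_0_iff)
    from assms[OF this]
    show "c \<le> (q ^ card (G t \<omega>) + (1 - q ^ card (G t \<omega>)) * q ^ N) ^ N + - 1 * q ^ (N * card (G t \<omega>))"
      by (simp add: power_mult[symmetric] mult.commute)
  qed simp
  also have "\<dots> \<le> u N (Suc t)" by (rule u_Suc_ge)
  finally show ?thesis .
qed

end

section \<open>Expected displacement\<close>

lemma gain_restrict:
  assumes "S \<subseteq> {1..N}"
  shows "gain N (restrict y ({1..N} \<times> {1..N} \<times> {t})) t S = gain N y t S"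
  unfolding gain_def using assms by (intro arg_cong[where f=Max] image_cong) auto

lemma (in prob_space) expectation_const: "expectation (\<lambda>\<omega>. c :: real) = c"
  by (simp add: prob_space)

context greedy_front
begin

lemma integrable_gain:
  assumes S: "S \<in> Pow {1..N} - {{}}" and t: "1 \<le> t"
  shows "integrable M (\<lambda>\<omega>. gain N (\<lambda>e. Y e \<omega>) t S)"
proof (rule Bochner_Integration.integrable_bound)
  have fin: "finite S" using S finite_subset by auto
  have sub: "{1..N} \<times> S \<times> {t} \<subseteq> {1..N} \<times> {1..N} \<times> {1..}" using S t by auto
  show "integrable M (\<lambda>\<omega>. \<Sum>e\<in>{1..N} \<times> S \<times> {t}. \<bar>Y e \<omega>\<bar>)"
    using sub by (intro Bochner_Integration.integrable_sum integrable_abs integrable) blast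
  show "(\<lambda>\<omega>. gain N (\<lambda>e. Y e \<omega>) t S) \<in> borel_measurable M"
    unfolding gain_def using sub fin by (intro borel_measurable_Max Y_measurable) blast+
  show "AE \<omega> in M. norm (gain N (\<lambda>e. Y e \<omega>) t S) \<le> norm (\<Sum>e\<in>{1..N} \<times> S \<times> {t}. \<bar>Y e \<omega>\<bar>)"
  proof (intro AE_I2)
    fix \<omega>
    obtain i j where ij: "i \<in> {1..N}" "j \<in> S" "gain N (\<lambda>e. Y e \<omega>) t S = Y (i, j, t) \<omega>"
      using gain_attained[OF N, of S "\<lambda>e. Y e \<omega>" t] S by auto
    have "\<bar>Y (i, j, t) \<omega>\<bar> \<le> (\<Sum>e\<in>{1..N} \<times> S \<times> {t}. \<bar>Y e \<omega>\<bar>)"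
      using ij fin by (intro member_le_sum[of _ _ "\<lambda>e. \<bar>Y e \<omega>\<bar>"]) auto
    then show "norm (gain N (\<lambda>e. Y e \<omega>) t S) \<le> norm (\<Sum>e\<in>{1..N} \<times> S \<times> {t}. \<bar>Y e \<omega>\<bar>)"
      using ij by simp
  qed
qed

lemma gain_step:
  shows integrable_gain_step: "integrable M (\<lambda>\<omega>. gain N (\<lambda>e. Y e \<omega>) (Suc t) (G t \<omega>))"
    and expectation_gain_step: "expectation (\<lambda>\<omega>. gain N (\<lambda>e. Y e \<omega>) (Suc t) (G t \<omega>))
      = expectation (\<lambda>\<omega>. expectation (\<lambda>\<omega>'. gain N (\<lambda>e. Y e \<omega>') (Suc t) (G t \<omega>)))"
proof -
  define h where "h S y = gain N y (Suc t) S" for S y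
  have meas: "h S \<in> borel_measurable (PiM ({1..N} \<times> {1..N} \<times> {Suc t}) (\<lambda>_. borel))"
    if "S \<in> Pow {1..N} - {{}}" for S
    unfolding h_def using that finite_subset[of S "{1..N}"] by (intro measurable_gain) auto
  have local: "h S (restrict y ({1..N} \<times> {1..N} \<times> {Suc t})) = h S y"
    if "S \<in> Pow {1..N} - {{}}" for S y
    unfolding h_def using that by (intro gain_restrict) auto
  have int: "integrable M (\<lambda>\<omega>. h S (\<lambda>e. Y e \<omega>))" if "S \<in> Pow {1..N} - {{}}" for S
    unfolding h_def using integrable_gain[OF that] by simp
  show "integrable M (\<lambda>\<omega>. gain N (\<lambda>e. Y e \<omega>) (Suc t) (G t \<omega>))"
    using integrable_step[of h, OF meas local int] by (simp only: h_def)
  show "expectation (\<lambda>\<omega>. gain N (\<lambda>e. Y e \<omega>) (Suc t) (G t \<omega>))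
      = expectation (\<lambda>\<omega>. expectation (\<lambda>\<omega>'. gain N (\<lambda>e. Y e \<omega>') (Suc t) (G t \<omega>)))"
    using expectation_step[of h, OF meas local int] by (simp only: h_def)
qed

lemma integrable_level: "integrable M (\<lambda>\<omega>. level N (\<lambda>e. Y e \<omega>) T)"
  unfolding level_def by (intro Bochner_Integration.integrable_sum integrable_gain_step)

lemma expectation_level:
  "expectation (\<lambda>\<omega>. level N (\<lambda>e. Y e \<omega>) T)
    = (\<Sum>t<T. expectation (\<lambda>\<omega>. expectation (\<lambda>\<omega>'. gain N (\<lambda>e. Y e \<omega>') (Suc t) (G t \<omega>))))"
proof -
  have "expectation (\<lambda>\<omega>. level N (\<lambda>e. Y e \<omega>) T)
      = (\<Sum>t<T. expectation (\<lambda>\<omega>. gain N (\<lambda>e. Y e \<omega>) (Suc t) (G t \<omega>)))"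
    unfolding level_def by (rule Bochner_Integration.integral_sum[OF integrable_gain_step])
  then show ?thesis by (simp only: expectation_gain_step)
qed

lemma sum_expectation_loss:
  "(\<Sum>t<T. expectation (\<lambda>\<omega>. a - D * q ^ (N * card (G t \<omega>)))) = a * real T - D * (\<Sum>t<T. u N t)"
proof -
  have "expectation (\<lambda>\<omega>. a - D * q ^ (N * card (G t \<omega>))) = a - D * u N t" for t
  proof -
    have "expectation (\<lambda>\<omega>. a - D * q ^ (N * card (G t \<omega>)))
        = expectation (\<lambda>\<omega>. a) - expectation (\<lambda>\<omega>. D * q ^ (N * card (G t \<omega>)))"
      by (rule Bochner_Integration.integral_diff[OF _ integrable_function_G]) simp
    then show ?thesis by (simp add: u_def prob_space)
  qed
  then show ?thesis by (simp add: sum_subtractf sum_distrib_left)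
qed

lemma expectation_level_ge:
  assumes "\<And>S t. S \<in> Pow {1..N} - {{}} \<Longrightarrow> 1 \<le> t \<Longrightarrow>
    a - D * q ^ (N * card S) \<le> expectation (\<lambda>\<omega>. gain N (\<lambda>e. Y e \<omega>) t S)"
  shows "a * real T - D * (\<Sum>t<T. u N t) \<le> expectation (\<lambda>\<omega>. level N (\<lambda>e. Y e \<omega>) T)"
  unfolding expectation_level sum_expectation_loss[symmetric]
  by (intro sum_mono integral_mono[OF integrable_function_G integrable_function_G] assms G_mem) simp

lemma expectation_level_le:
  assumes "\<And>S t. S \<in> Pow {1..N} - {{}} \<Longrightarrow> 1 \<le> t \<Longrightarrow>
    expectation (\<lambda>\<omega>. gain N (\<lambda>e. Y e \<omega>) t S) \<le> a - D * q ^ (N * card S)"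
  shows "expectation (\<lambda>\<omega>. level N (\<lambda>e. Y e \<omega>) T) \<le> a * real T - D * (\<Sum>t<T. u N t)"
  unfolding expectation_level sum_expectation_loss[symmetric]
  by (intro sum_mono integral_mono[OF integrable_function_G integrable_function_G] assms G_mem) simp

lemma gain_le:
  assumes "S \<in> Pow {1..N} - {{}}"
  shows "gain N (\<lambda>e. Y e \<omega>) t S \<le> a"
proof -
  obtain i j where "gain N (\<lambda>e. Y e \<omega>) t S = Y (i, j, t) \<omega>"
    using gain_attained[OF N, of S "\<lambda>e. Y e \<omega>" t] assms
    by (metis DiffE PowD singletonI)
  then show ?thesis using Y_cases[of "(i, j, t)" \<omega>] ba by auto
qed

lemma level_le: "level N (\<lambda>e. Y e \<omega>) T \<le> a * real T"
proof -
  have "level N (\<lambda>e. Y e \<omega>) T \<le> (\<Sum>s<T. a)"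
    unfolding level_def by (intro sum_mono gain_le G_mem)
  then show ?thesis by (simp add: mult.commute)
qed

text \<open>Losing more than \<open>a - b + \<epsilon>\<close> requires every edge weight to be at most \<open>b - \<epsilon>\<close>; the size of the
  loss is then controlled by the single weight at \<open>e0\<close>.\<close>

lemma expectation_gain_ge:
  assumes S: "S \<in> Pow {1..N} - {{}}" and t: "1 \<le> t" and \<epsilon>: "0 < \<epsilon>"
    and r: "\<And>e. e \<in> {1..N} \<times> {1..N} \<times> {1..} \<Longrightarrow> prob {\<omega> \<in> space M. Y e \<omega> \<le> b - \<epsilon>} \<le> r"
    and C: "\<And>e. e \<in> {1..N} \<times> {1..N} \<times> {1..} \<Longrightarrow> expectation (\<lambda>\<omega>. max 0 (b - Y e \<omega>)) \<le> C"
  shows "a - ((a - b + \<epsilon>) * q ^ (N * card S) + C * r ^ (N * card S - 1))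
    \<le> expectation (\<lambda>\<omega>. gain N (\<lambda>e. Y e \<omega>) t S)"
proof -
  define E where "E = {1..N} \<times> S \<times> {t}"
  have SN: "S \<subseteq> {1..N}" "S \<noteq> {}" using S by auto
  have fin: "finite E" using finite_subset[OF SN(1)] by (simp add: E_def)
  have sub: "E \<subseteq> {1..N} \<times> {1..N} \<times> {1..}" using SN t by (auto simp: E_def)
  have card: "card E = N * card S" by (simp add: E_def card_cartesian_product)
  obtain j0 where "j0 \<in> S" using SN by blast
  then have e0: "(1, j0, t) \<in> E" using N by (simp add: E_def)
  define e0 where "e0 = (1::nat, j0, t)"
  have e0: "e0 \<in> E" using e0 by (simp add: e0_def)
  define f where "f e x = (if e = e0 then max 0 (b - x) else indicat_real {..b - \<epsilon>} x)" for e x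
  have f0: "0 \<le> f e x" for e x by (simp add: f_def)
  have fmeas: "f e \<in> borel_measurable borel" for e
    by (cases "e = e0") (auto simp: f_def[abs_def])
  have fint: "integrable M (\<lambda>\<omega>. f e (Y e \<omega>))" if "e \<in> E" for e
  proof -
    have eI: "e \<in> {1..N} \<times> {1..N} \<times> {1..}" using that sub by blast
    show ?thesis
      using integrable[OF eI] integrable_indicator_threshold[OF eI]
      by (cases "e = e0") (auto simp: f_def)
  qed
  have "expectation (\<lambda>\<omega>. \<Prod>e\<in>E. f e (Y e \<omega>)) = (\<Prod>e\<in>E. expectation (\<lambda>\<omega>. f e (Y e \<omega>)))"
    by (rule expectation_prod[OF fin sub fmeas fint])
  also have "\<dots> = expectation (\<lambda>\<omega>. max 0 (b - Y e0 \<omega>)) * (\<Prod>e\<in>E - {e0}. expectation (\<lambda>\<omega>. f e (Y e \<omega>)))"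
    by (simp add: prod.remove[OF fin e0] f_def)
  also have "\<dots> \<le> C * (\<Prod>e\<in>E - {e0}. r)"
  proof (intro mult_mono prod_mono conjI prod_nonneg)
    show e0C: "expectation (\<lambda>\<omega>. max 0 (b - Y e0 \<omega>)) \<le> C" using C e0 sub by blast
    have "0 \<le> expectation (\<lambda>\<omega>. max 0 (b - Y e0 \<omega>))" by (intro integral_nonneg_AE) auto
    with e0C show "0 \<le> C" by linarith
    fix e assume e: "e \<in> E - {e0}"
    show "0 \<le> expectation (\<lambda>\<omega>. f e (Y e \<omega>))" using f0 by (intro integral_nonneg_AE) auto
    have "expectation (\<lambda>\<omega>. f e (Y e \<omega>)) = expectation (\<lambda>\<omega>. indicat_real {..b - \<epsilon>} (Y e \<omega>))"
      using e by (simp add: f_def)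
    also have "\<dots> = prob {\<omega> \<in> space M. Y e \<omega> \<le> b - \<epsilon>}"
      using e sub by (intro expectation_indicator_threshold) auto
    also have "\<dots> \<le> r" using e sub r by blast
    finally show "expectation (\<lambda>\<omega>. f e (Y e \<omega>)) \<le> r" .
  next
    fix e assume "e \<in> E - {e0}"
    then show "0 \<le> expectation (\<lambda>\<omega>. f e (Y e \<omega>))" using f0 by (intro integral_nonneg_AE) auto
  qed
  also have "(\<Prod>e\<in>E - {e0}. r) = r ^ (N * card S - 1)"
    using fin e0 card by (simp add: card_Diff_singleton)
  finally have X: "expectation (\<lambda>\<omega>. \<Prod>e\<in>E. f e (Y e \<omega>)) \<le> C * r ^ (N * card S - 1)" .
  have int1: "integrable M (\<lambda>\<omega>. \<Prod>e\<in>E. f e (Y e \<omega>))"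
    by (rule integrable_prod[OF fin sub fmeas fint])
  have int2: "integrable M (\<lambda>\<omega>. (a - b + \<epsilon>) * (\<Prod>e\<in>E. indicat_real {..b} (Y e \<omega>)))"
    by (intro integrable_mult_right integrable_all_low fin sub)
  have "a - ((a - b + \<epsilon>) * (\<Prod>e\<in>E. indicat_real {..b} (Y e \<omega>)) + (\<Prod>e\<in>E. f e (Y e \<omega>)))
      \<le> gain N (\<lambda>e. Y e \<omega>) t S" for \<omega>
  proof -
    define g where "g = gain N (\<lambda>e. Y e \<omega>) t S"
    have ge: "Y e \<omega> \<le> g" if "e \<in> E" for e
      using that gain_ge[OF _ _ SN(1), of _ _ "\<lambda>e. Y e \<omega>" t] by (auto simp: E_def g_def)
    have "g = a \<or> g \<le> b"
      using gain_attained[OF N SN(2,1), of "\<lambda>e. Y e \<omega>" t] Y_cases unfolding g_def by metis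
    have nn: "0 \<le> (\<Prod>e\<in>E. f e (Y e \<omega>))" "0 \<le> (\<Prod>e\<in>E. indicat_real {..b} (Y e \<omega>))"
      using f0 by (auto intro!: prod_nonneg)
    consider "g = a" | "g \<le> b" "b - \<epsilon> < g" | "g \<le> b - \<epsilon>" using \<open>g = a \<or> g \<le> b\<close> by linarith
    then show ?thesis unfolding g_def[symmetric]
    proof cases
      case 1
      then show "a - ((a - b + \<epsilon>) * (\<Prod>e\<in>E. indicat_real {..b} (Y e \<omega>)) + (\<Prod>e\<in>E. f e (Y e \<omega>))) \<le> g"
        using nn mult_nonneg_nonneg[OF _ nn(2), of "a - b + \<epsilon>"] ba \<epsilon> by linarith
    next
      case 2
      have "\<not> (\<exists>e\<in>E. b < Y e \<omega>)" using ge 2 by fastforce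
      then have "(\<Prod>e\<in>E. indicat_real {..b} (Y e \<omega>)) = 1"
        using prod_indicator_atMost[OF fin, of b "\<lambda>e. Y e \<omega>"] by simp
      then show "a - ((a - b + \<epsilon>) * (\<Prod>e\<in>E. indicat_real {..b} (Y e \<omega>)) + (\<Prod>e\<in>E. f e (Y e \<omega>))) \<le> g"
        using nn 2 by simp
    next
      case 3
      have "\<not> (\<exists>e\<in>E. b < Y e \<omega>)" using ge 3 \<epsilon> by fastforce
      then have 1: "(\<Prod>e\<in>E. indicat_real {..b} (Y e \<omega>)) = 1"
        using prod_indicator_atMost[OF fin, of b "\<lambda>e. Y e \<omega>"] by simp
      have "(\<Prod>e\<in>E - {e0}. f e (Y e \<omega>)) = 1"
      proof (intro prod.neutral ballI)
        fix e assume "e \<in> E - {e0}"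
        then show "f e (Y e \<omega>) = 1" using ge[of e] 3 by (simp add: f_def)
      qed
      then have "(\<Prod>e\<in>E. f e (Y e \<omega>)) = max 0 (b - Y e0 \<omega>)"
        by (simp add: prod.remove[OF fin e0] f_def)
      then show "a - ((a - b + \<epsilon>) * (\<Prod>e\<in>E. indicat_real {..b} (Y e \<omega>)) + (\<Prod>e\<in>E. f e (Y e \<omega>))) \<le> g"
        using 1 ge[OF e0] \<epsilon> by simp
    qed
  qed
  then have "expectation (\<lambda>\<omega>. a - ((a - b + \<epsilon>) * (\<Prod>e\<in>E. indicat_real {..b} (Y e \<omega>)) + (\<Prod>e\<in>E. f e (Y e \<omega>))))
      \<le> expectation (\<lambda>\<omega>. gain N (\<lambda>e. Y e \<omega>) t S)"
    by (intro integral_mono[OF Bochner_Integration.integrable_diff[OF _ Bochner_Integration.integrable_add[OF int2 int1]]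
          integrable_gain[OF S t]]) auto
  also have "expectation (\<lambda>\<omega>. a - ((a - b + \<epsilon>) * (\<Prod>e\<in>E. indicat_real {..b} (Y e \<omega>)) + (\<Prod>e\<in>E. f e (Y e \<omega>))))
      = expectation (\<lambda>\<omega>. a)
        - expectation (\<lambda>\<omega>. (a - b + \<epsilon>) * (\<Prod>e\<in>E. indicat_real {..b} (Y e \<omega>)) + (\<Prod>e\<in>E. f e (Y e \<omega>)))"
    by (rule Bochner_Integration.integral_diff[OF _ Bochner_Integration.integrable_add[OF int2 int1]]) simp
  also have "\<dots> = a - (expectation (\<lambda>\<omega>. (a - b + \<epsilon>) * (\<Prod>e\<in>E. indicat_real {..b} (Y e \<omega>)))
      + expectation (\<lambda>\<omega>. \<Prod>e\<in>E. f e (Y e \<omega>)))"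
    unfolding Bochner_Integration.integral_add[OF int2 int1] by (simp only: expectation_const)
  also have "\<dots> = a - ((a - b + \<epsilon>) * q ^ (N * card S) + expectation (\<lambda>\<omega>. \<Prod>e\<in>E. f e (Y e \<omega>)))"
    by (simp only: integral_mult_right_zero expectation_all_low[OF fin sub] card)
  finally show ?thesis using X by linarith
qed

lemma expectation_gain_two_valued:
  assumes S: "S \<in> Pow {1..N} - {{}}" and t: "1 \<le> t"
    and Y: "\<And>e \<omega>. Y e \<omega> = a \<or> Y e \<omega> = b"
  shows "expectation (\<lambda>\<omega>. gain N (\<lambda>e. Y e \<omega>) t S) = a - (a - b) * q ^ (N * card S)"
proof -
  have SN: "S \<subseteq> {1..N}" "S \<noteq> {}" "finite S" using S finite_subset[of S "{1..N}"] by auto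
  have "gain N (\<lambda>e. Y e \<omega>) t S = a - (a - b) * (\<Prod>e\<in>{1..N} \<times> S \<times> {t}. indicat_real {..b} (Y e \<omega>))" for \<omega>
  proof (cases "hits N b (\<lambda>e. Y e \<omega>) t S = {}")
    case True
    obtain i j where ij: "i \<in> {1..N}" "j \<in> S" "gain N (\<lambda>e. Y e \<omega>) t S = Y (i, j, t) \<omega>"
      using gain_attained[OF N SN(2,1), of "\<lambda>e. Y e \<omega>" t] by metis
    moreover have "\<not> b < Y (i, j, t) \<omega>" using True ij by (auto simp: hits_def)
    ultimately have "gain N (\<lambda>e. Y e \<omega>) t S = b" using Y[of "(i, j, t)" \<omega>] ba by auto
    then show ?thesis using prod_indicator_eq_hits_empty[OF SN(3), where y="\<lambda>e. Y e \<omega>"] True by simp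
  next
    case False
    then show ?thesis
      using gain_eq_of_hits[OF SN(1) Y_cases ba False]
        prod_indicator_eq_hits_empty[OF SN(3), where y="\<lambda>e. Y e \<omega>"] by simp
  qed
  then have "expectation (\<lambda>\<omega>. gain N (\<lambda>e. Y e \<omega>) t S)
      = expectation (\<lambda>\<omega>. a - (a - b) * (\<Prod>e\<in>{1..N} \<times> S \<times> {t}. indicat_real {..b} (Y e \<omega>)))"
    by simp
  also have "\<dots> = expectation (\<lambda>\<omega>. a)
      - expectation (\<lambda>\<omega>. (a - b) * (\<Prod>e\<in>{1..N} \<times> S \<times> {t}. indicat_real {..b} (Y e \<omega>)))"
    by (rule Bochner_Integration.integral_diff[OF _ integrable_mult_right[OF integrable_fail[OF SN(1) t]]]) simp
  also have "\<dots> = a - (a - b) * q ^ (N * card S)"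
    by (simp only: integral_mult_right_zero expectation_fail[OF SN(1) t] expectation_const)
  finally show ?thesis .
qed

end

text \<open>Pointwise v \<le> Z + max 0 (v - Z). The lower bound on Z makes the positive part
  bounded, and since Z dominates X it tends to 0 almost surely, so its expectation vanishes by
  dominated convergence.\<close>

lemma (in prob_space) AE_limit_le_limit_of_expectation:
  fixes X Z :: "nat \<Rightarrow> 'a \<Rightarrow> real" and v B L :: real and c :: "nat \<Rightarrow> real"
  assumes lim: "AE \<omega> in M. (\<lambda>t. X t \<omega>) \<longlonglongrightarrow> v" and le: "AE \<omega> in M. \<forall>t. X t \<omega> \<le> Z t \<omega>"
    and int: "\<And>t. integrable M (Z t)" and lb: "\<And>t \<omega>. - B \<le> Z t \<omega>"
    and E: "\<forall>\<^sub>F t in sequentially. expectation (Z t) \<le> c t" and c: "c \<longlonglongrightarrow> L"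
  shows "v \<le> L"
proof -
  define D where "D t \<omega> = max 0 (v - Z t \<omega>)" for t \<omega>
  have intD: "integrable M (D t)" for t
    unfolding D_def using int[of t] by (intro integrable_max Bochner_Integration.integrable_diff) auto
  have "(\<lambda>t. expectation (D t)) \<longlonglongrightarrow> expectation (\<lambda>\<omega>. 0)"
  proof (rule integral_dominated_convergence[where w="\<lambda>\<omega>. \<bar>v + B\<bar>"])
    show "D t \<in> borel_measurable M" for t using intD by auto
    show "AE \<omega> in M. norm (D t \<omega>) \<le> \<bar>v + B\<bar>" for t
    proof (intro AE_I2)
      fix \<omega>
      show "norm (D t \<omega>) \<le> \<bar>v + B\<bar>" using lb[of t \<omega>] by (simp add: D_def)
    qed
    show "AE \<omega> in M. (\<lambda>t. D t \<omega>) \<longlonglongrightarrow> 0"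
      using lim le
    proof eventually_elim
      case (elim \<omega>)
      have "(\<lambda>t. max 0 (v - X t \<omega>)) \<longlonglongrightarrow> max 0 (v - v)"
        using elim(1) by (intro tendsto_intros)
      then have l: "(\<lambda>t. max 0 (v - X t \<omega>)) \<longlonglongrightarrow> 0" by simp
      show ?case
      proof (rule tendsto_sandwich[OF _ _ tendsto_const l])
        show "\<forall>\<^sub>F t in sequentially. 0 \<le> D t \<omega>" by (simp add: D_def)
        have "D t \<omega> \<le> max 0 (v - X t \<omega>)" for t
          using elim(2)[rule_format, of t] by (auto simp: D_def)
        then show "\<forall>\<^sub>F t in sequentially. D t \<omega> \<le> max 0 (v - X t \<omega>)" by simp
      qed
    qed
  qed auto
  then have lim: "(\<lambda>t. c t + expectation (D t)) \<longlonglongrightarrow> L + 0" using c by (intro tendsto_intros) simp_all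
  have "\<forall>\<^sub>F t in sequentially. v \<le> c t + expectation (D t)"
    using E
  proof eventually_elim
    case (elim t)
    have "v = expectation (\<lambda>\<omega>. v)" by (simp add: prob_space)
    also have "\<dots> \<le> expectation (\<lambda>\<omega>. Z t \<omega> + D t \<omega>)"
      using int[of t] intD[of t] by (intro integral_mono) (auto simp: D_def)
    also have "\<dots> = expectation (Z t) + expectation (D t)"
      using int[of t] intD[of t] by simp
    finally show ?case using elim by simp
  qed
  from tendsto_lowerbound[OF lim this] show ?thesis by simp
qed

section \<open>The speed of the front\<close>

text \<open>One system of fixed size N; the estimates of \<open>v\<close> proved here are
  non-asymptotic, and N tends to infinity only in the final theorem.\<close>

locale iid_front = prob_space +
  fixes N :: nat and \<xi> :: "'a \<Rightarrow> real" and X :: "nat \<times> nat \<times> nat \<Rightarrow> 'a \<Rightarrow> real"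
    and x0 :: "nat \<Rightarrow> real" and a b p v :: real
  assumes N: "1 \<le> N" and ba: "b < a" and p: "0 < p" "p < 1"
    and integrable: "integrable M \<xi>"
    and above: "prob {\<omega> \<in> space M. \<xi> \<omega> > a} = 0"
    and gap: "prob {\<omega> \<in> space M. b < \<xi> \<omega> \<and> \<xi> \<omega> < a} = 0"
    and atom: "prob {\<omega> \<in> space M. \<xi> \<omega> = a} = p"
    and indep: "indep_vars (\<lambda>_. borel) X ({1..N} \<times> {1..N} \<times> {1..})"
    and ident: "\<And>e. e \<in> {1..N} \<times> {1..N} \<times> {1..} \<Longrightarrow> distr M borel (X e) = distr M borel \<xi>"
    and speed: "AE \<omega> in M. (\<lambda>t. front_max N x0 (\<lambda>i j s. X (i, j, s) \<omega>) t / real t) \<longlonglongrightarrow> v"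
begin

section \<open>Transfer between the weights and \<xi>\<close>

lemma X_measurable: "e \<in> {1..N} \<times> {1..N} \<times> {1..} \<Longrightarrow> X e \<in> borel_measurable M"
  using indep unfolding indep_vars_def by blast

lemma \<xi>_measurable [measurable]: "\<xi> \<in> borel_measurable M"
  using integrable by simp

lemma identical_distribution:
  assumes e: "e \<in> {1..N} \<times> {1..N} \<times> {1..}" and f: "f \<in> borel_measurable borel"
  shows integrable_transfer: "integrable M (\<lambda>\<omega>. f (X e \<omega>) :: real) \<longleftrightarrow> integrable M (\<lambda>\<omega>. f (\<xi> \<omega>))"
    and expectation_transfer: "expectation (\<lambda>\<omega>. f (X e \<omega>)) = expectation (\<lambda>\<omega>. f (\<xi> \<omega>))"
  using integrable_distr_eq[OF X_measurable[OF e] f] integrable_distr_eq[OF \<xi>_measurable f]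
    integral_distr[OF X_measurable[OF e] f] integral_distr[OF \<xi>_measurable f] ident[OF e] by simp_all

lemma prob_transfer:
  assumes e: "e \<in> {1..N} \<times> {1..N} \<times> {1..}" and A: "A \<in> sets borel"
  shows "prob {\<omega> \<in> space M. X e \<omega> \<in> A} = prob {\<omega> \<in> space M. \<xi> \<omega> \<in> A}"
  using measure_distr[OF X_measurable[OF e] A] measure_distr[OF \<xi>_measurable A] ident[OF e]
  by (simp add: vimage_def Int_def conj_commute)

lemma prob_le_b: "prob {\<omega> \<in> space M. \<xi> \<omega> \<le> b} = 1 - p"
proof -
  have "prob {\<omega> \<in> space M. b < \<xi> \<omega>} = prob ({\<omega> \<in> space M. \<xi> \<omega> > a}
      \<union> ({\<omega> \<in> space M. b < \<xi> \<omega> \<and> \<xi> \<omega> < a} \<union> {\<omega> \<in> space M. \<xi> \<omega> = a}))"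
    using ba by (intro arg_cong[where f=prob]) auto
  also have "\<dots> = p"
    using above gap atom by (subst finite_measure_Union; (subst finite_measure_Union)?) auto
  finally have *: "prob {\<omega> \<in> space M. b < \<xi> \<omega>} = p" .
  have "{\<omega> \<in> space M. b < \<xi> \<omega>} \<in> events" by measurable
  moreover have "space M - {\<omega> \<in> space M. b < \<xi> \<omega>} = {\<omega> \<in> space M. \<xi> \<omega> \<le> b}" by auto
  ultimately show ?thesis using prob_compl[of "{\<omega> \<in> space M. b < \<xi> \<omega>}"] * by simp
qed

lemma AE_values: "AE \<omega> in M. \<xi> \<omega> = a \<or> \<xi> \<omega> \<le> b"
proof -
  have "AE \<omega> in M. \<not> (\<xi> \<omega> > a)" "AE \<omega> in M. \<not> (b < \<xi> \<omega> \<and> \<xi> \<omega> < a)"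
    using above gap by (auto simp: prob_Collect_eq_0)
  then show ?thesis by eventually_elim auto
qed

text \<open>A single null set serves all edges and all times, so the pathwise comparisons can be
  applied to entire trajectories.\<close>

lemma AE_values_all:
  "AE \<omega> in M. \<forall>e. e \<in> {1..N} \<times> {1..N} \<times> {1..} \<longrightarrow> X e \<omega> = a \<or> X e \<omega> \<le> b"
  unfolding AE_all_countable
proof
  fix e
  show "AE \<omega> in M. e \<in> {1..N} \<times> {1..N} \<times> {1..} \<longrightarrow> X e \<omega> = a \<or> X e \<omega> \<le> b"
  proof (cases "e \<in> {1..N} \<times> {1..N} \<times> {1..}")
    case True
    have m: "{x :: real. x = a \<or> x \<le> b} \<in> sets borel" by measurable
    have "AE x in distr M borel \<xi>. x = a \<or> x \<le> b"
      using AE_values m by (subst AE_distr_iff) auto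
    then have "AE x in distr M borel (X e). x = a \<or> x \<le> b" by (simp only: ident[OF True])
    then have "AE \<omega> in M. X e \<omega> = a \<or> X e \<omega> \<le> b"
      using m X_measurable[OF True] by (subst (asm) AE_distr_iff) auto
    then show ?thesis by auto
  qed auto
qed

text \<open>Everything above \<open>b\<close> is sent to \<open>a\<close>, which changes \<xi> only
  on a null set. The two uses differ in the treatment of values up to \<open>b\<close>: raised to
  \<open>b\<close>, or kept.\<close>

lemma greedy_front_clip:
  assumes f: "f \<in> borel_measurable borel" and int: "integrable M (\<lambda>\<omega>. f (\<xi> \<omega>))"
    and high: "\<And>x. b < x \<Longrightarrow> f x = a" and low: "\<And>x. x \<le> b \<Longrightarrow> f x \<le> b"
  shows "greedy_front M N (\<lambda>e \<omega>. f (X e \<omega>)) a b (1 - p)"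
proof unfold_locales
  show "indep_vars (\<lambda>_. borel) (\<lambda>e \<omega>. f (X e \<omega>)) ({1..N} \<times> {1..N} \<times> {1..})"
    using indep_vars_compose2[OF indep, of "\<lambda>_. f" "\<lambda>_. borel"] f by simp
  fix e :: "nat \<times> nat \<times> nat" assume e: "e \<in> {1..N} \<times> {1..N} \<times> {1..}"
  show "integrable M (\<lambda>\<omega>. f (X e \<omega>))" using integrable_transfer[OF e f] int by simp
  have "{\<omega> \<in> space M. f (X e \<omega>) \<le> b} = {\<omega> \<in> space M. X e \<omega> \<in> {..b}}"
    using high low ba by (metis atMost_iff not_le)
  then have "prob {\<omega> \<in> space M. f (X e \<omega>) \<le> b} = prob {\<omega> \<in> space M. X e \<omega> \<in> {..b}}" by simp
  also have "\<dots> = prob {\<omega> \<in> space M. \<xi> \<omega> \<in> {..b}}" using e by (rule prob_transfer) simp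
  finally show "prob {\<omega> \<in> space M. f (X e \<omega>) \<le> b} = 1 - p" using prob_le_b by simp
next
  show "f (X e \<omega>) = a \<or> f (X e \<omega>) \<le> b" for e \<omega> using high low by (meson not_le)
qed (use N p ba in auto)

text \<open>Each failure costs the rounded-up process exactly a - b, and \<phi> bounds the failure
  probability from below whatever the number k of leaders one step earlier.\<close>

lemma speed_le:
  assumes \<phi>: "\<And>k. k \<in> {1..N} \<Longrightarrow>
    \<phi> \<le> ((1 - p) ^ k + (1 - (1 - p) ^ k) * (1 - p) ^ N) ^ N - ((1 - p) ^ k) ^ N"
  shows "v \<le> a - (a - b) * \<phi>"
proof -
  define f where "f x = (if b < x then a else b)" for x
  have f: "f \<in> borel_measurable borel" unfolding f_def[abs_def] by measurable
  have "integrable M (\<lambda>\<omega>. f (\<xi> \<omega>))"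
    using f by (intro integrable_const_bound[where B="\<bar>a\<bar> + \<bar>b\<bar>"]) (auto simp: f_def)
  then interpret greedy_front M N "\<lambda>e \<omega>. f (X e \<omega>)" a b "1 - p"
    using f by (intro greedy_front_clip) (auto simp: f_def)
  define c where "c = Max (x0 ` {1..N})"
  show ?thesis
  proof (rule AE_limit_le_limit_of_expectation[OF speed])
    let ?Z = "\<lambda>t \<omega>. (c + level N (\<lambda>e. f (X e \<omega>)) t) / real t"
    show "AE \<omega> in M. \<forall>t. front_max N x0 (\<lambda>i j s. X (i, j, s) \<omega>) t / real t \<le> ?Z t \<omega>"
      using AE_values_all
    proof eventually_elim
      case (elim \<omega>)
      have "front_max N x0 (\<lambda>i j s. X (i, j, s) \<omega>) t \<le> c + level N (\<lambda>e. f (X e \<omega>)) t" for t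
      proof (rule front_max_le_level[OF N less_imp_le[OF ba]])
        show "x0 i \<le> c" if "i \<in> {1..N}" for i
          using that unfolding c_def by (intro Max_ge) auto
        show "X (i, j, s) \<omega> \<le> f (X (i, j, s) \<omega>)" if "i \<in> {1..N}" "j \<in> {1..N}" "1 \<le> s" for i j s
          using elim[rule_format, of "(i, j, s)"] that by (auto simp: f_def)
      qed (simp add: f_def)
      then show ?case by (intro allI divide_right_mono) auto
    qed
    show "integrable M (?Z t)" for t using integrable_level by simp
    \<comment> \<open>Rounded weights are at least \<open>b\<close>, so the level is at least b t.
      At t = 0 the quotient is 0 by the convention for division by zero.\<close>
    show "- (\<bar>c\<bar> + \<bar>b\<bar>) \<le> ?Z t \<omega>" for t \<omega>
    proof (cases "t = 0")
      case False
      have "b \<le> f x" for x using ba by (simp add: f_def)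
      then have "b \<le> gain N (\<lambda>e. f (X e \<omega>)) (Suc s) (leaders N (\<lambda>e. f (X e \<omega>)) s)" for s
        using gain_attained[OF N leaders_nonempty[OF N] leaders_subset] by metis
      then have "real t * b \<le> level N (\<lambda>e. f (X e \<omega>)) t"
        unfolding level_def using sum_bounded_below[of "{..<t}" b] by simp
      moreover have "- (real t * \<bar>c\<bar>) \<le> c" "- (real t * \<bar>b\<bar>) \<le> real t * b"
        using False mult_right_mono[of 1 "real t" "\<bar>c\<bar>"] mult_left_mono[of "- \<bar>b\<bar>" b "real t"] by auto
      ultimately show ?thesis using False by (simp add: field_simps)
    qed simp
    have "expectation (?Z (Suc T)) \<le> (c + (a * real (Suc T) - (a - b) * (real T * \<phi>))) / real (Suc T)" for T
    proof -
      have "expectation (\<lambda>\<omega>. level N (\<lambda>e. f (X e \<omega>)) (Suc T))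
          \<le> a * real (Suc T) - (a - b) * (\<Sum>t<Suc T. u N t)"
        by (rule expectation_level_le, subst expectation_gain_two_valued) (auto simp: f_def)
      \<comment> \<open>The bound \<phi> starts at time 1, so the first summand is only known to be
        nonnegative. The lost summand disappears after division by time.\<close>
      also have "real T * \<phi> \<le> (\<Sum>t<Suc T. u N t)"
      proof -
        have "real T * \<phi> \<le> (\<Sum>t<T. u N (Suc t))"
          using sum_bounded_below[of "{..<T}" \<phi> "\<lambda>t. u N (Suc t)"] u_N_Suc_ge[of \<phi>] \<phi> by simp
        moreover have "0 \<le> u N 0" unfolding u_def using q by (intro integral_nonneg_AE) auto
        ultimately show ?thesis by (simp only: sum.lessThan_Suc_shift)
      qed
      then have "a * real (Suc T) - (a - b) * (\<Sum>t<Suc T. u N t)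
          \<le> a * real (Suc T) - (a - b) * (real T * \<phi>)"
        using ba by (intro diff_left_mono mult_left_mono) auto
      finally have "c + expectation (\<lambda>\<omega>. level N (\<lambda>e. f (X e \<omega>)) (Suc T))
          \<le> c + (a * real (Suc T) - (a - b) * (real T * \<phi>))" by simp
      moreover have "expectation (?Z (Suc T)) = (c + expectation (\<lambda>\<omega>. level N (\<lambda>e. f (X e \<omega>)) (Suc T))) / real (Suc T)"
        using integrable_level by (simp add: prob_space)
      ultimately show ?thesis by (simp only: divide_right_mono of_nat_0_le_iff)
    qed
    then have "expectation (?Z t) \<le> c / real t + a - (a - b) * \<phi> * (1 - 1 / real t)" if "1 \<le> t" for t
    proof -
      obtain T where T: "t = Suc T" using \<open>1 \<le> t\<close> by (cases t) auto
      have "(c + (a * real (Suc T) - (a - b) * (real T * \<phi>))) / real (Suc T)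
          = c / real (Suc T) + a - (a - b) * \<phi> * (1 - 1 / real (Suc T))"
      proof -
        have "(c + (a * n - D * ((n - 1) * \<phi>))) / n = c / n + a - D * \<phi> * (1 - 1 / n)"
          if "n \<noteq> 0" for n D :: real
          using that by (simp add: field_simps)
        from this[of "real (Suc T)" "a - b"] show ?thesis by simp
      qed
      then show ?thesis
        using \<open>expectation (?Z (Suc T)) \<le> _\<close> unfolding T by simp
    qed
    then show "\<forall>\<^sub>F t in sequentially. expectation (?Z t) \<le> c / real t + a - (a - b) * \<phi> * (1 - 1 / real t)"
      by (intro eventually_mono[OF eventually_ge_at_top[of "1::nat"]])
    have "(\<lambda>t. c / real t + a - (a - b) * \<phi> * (1 - 1 / real t)) \<longlonglongrightarrow> 0 + a - (a - b) * \<phi> * (1 - 0)"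
      by (intro tendsto_intros lim_const_over_n)
    then show "(\<lambda>t. c / real t + a - (a - b) * \<phi> * (1 - 1 / real t)) \<longlonglongrightarrow> a - (a - b) * \<phi>"
      by simp
  qed
qed

text \<open>Here r is the conditional probability of \<xi> \<le> b - \<epsilon> given \<xi> \<le> b.
  The first factor bounds the mean loss per failure, the second the failure probability uniformly in
  time.\<close>

lemma speed_ge:
  fixes \<epsilon> r y R \<eta> :: real
  assumes \<epsilon>: "0 < \<epsilon>" and r: "r = prob {\<omega> \<in> space M. \<xi> \<omega> \<le> b - \<epsilon>} / (1 - p)" "r \<le> 1"
    and y: "0 < y" and R: "0 < R" and \<eta>: "0 < \<eta>" "\<eta> \<le> p / 2"
    and key: "\<And>s. 1 \<le> s \<Longrightarrow> (1 + (1 - p) ^ s) ^ N - 1 + R ^ N * (y + (1 - p) ^ s) ^ N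
           \<le> \<eta> * (1 + R ^ N * y ^ s)"
  shows "a - (a - b + \<epsilon> + expectation (\<lambda>\<omega>. max 0 (b - \<xi> \<omega>)) / (1 - p) * r ^ (N - 1))
      * ((1 - p) ^ (N\<^sup>2) * ((2 ^ N + 2 / p * (\<eta> * (2 ^ N + (R * (1 + y)) ^ N)
           + ((2 - p) ^ N + (R * (1 - p + y)) ^ N))) / (1 - (1 - p) ^ N))) \<le> v"
    (is "a - ?D * ?W \<le> v")
proof -
  define f where "f x = (if b < x then a else x)" for x
  have f: "f \<in> borel_measurable borel" unfolding f_def[abs_def] by measurable
  have "integrable M (\<lambda>\<omega>. f (\<xi> \<omega>))"
  proof (rule Bochner_Integration.integrable_bound)
    show "integrable M (\<lambda>\<omega>. \<bar>a\<bar> + \<bar>\<xi> \<omega>\<bar>)" using integrable by simp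
    show "(\<lambda>\<omega>. f (\<xi> \<omega>)) \<in> borel_measurable M" using f by measurable
  qed (auto simp: f_def)
  then interpret greedy_front M N "\<lambda>e \<omega>. f (X e \<omega>)" a b "1 - p"
    using f by (intro greedy_front_clip) (auto simp: f_def)
  define c where "c = Min (x0 ` {1..N})"
  define C where "C = expectation (\<lambda>\<omega>. max 0 (b - \<xi> \<omega>))"
  have C0: "0 \<le> C" unfolding C_def by (intro integral_nonneg_AE) auto
  have r0: "0 \<le> r" using p r by simp
  have D0: "0 \<le> ?D" using r0 C0 ba p \<epsilon> unfolding C_def[symmetric] by simp
  have W: "u N t \<le> ?W" for t
    using u_N_le[OF y R \<eta>(1) _ key, of t] \<eta> by simp
  have gain: "a - ?D * (1 - p) ^ (N * card S) \<le> expectation (\<lambda>\<omega>. gain N (\<lambda>e. f (X e \<omega>)) t S)"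
    if S: "S \<in> Pow {1..N} - {{}}" and t: "1 \<le> t" for S t
  proof -
    have low: "f x \<le> b - \<epsilon> \<longleftrightarrow> x \<le> b - \<epsilon>" for x using ba \<epsilon> by (auto simp: f_def)
    have "a - ((a - b + \<epsilon>) * (1 - p) ^ (N * card S) + C * (r * (1 - p)) ^ (N * card S - 1))
        \<le> expectation (\<lambda>\<omega>. gain N (\<lambda>e. f (X e \<omega>)) t S)"
    proof (rule expectation_gain_ge[OF S t \<epsilon>])
      fix e :: "nat \<times> nat \<times> nat" assume e: "e \<in> {1..N} \<times> {1..N} \<times> {1..}"
      have "prob {\<omega> \<in> space M. f (X e \<omega>) \<le> b - \<epsilon>} = prob {\<omega> \<in> space M. X e \<omega> \<in> {..b - \<epsilon>}}"
        unfolding low by simp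
      also have "\<dots> = prob {\<omega> \<in> space M. \<xi> \<omega> \<in> {..b - \<epsilon>}}" using e by (rule prob_transfer) simp
      also have "\<dots> = r * (1 - p)" using r p by simp
      finally show "prob {\<omega> \<in> space M. f (X e \<omega>) \<le> b - \<epsilon>} \<le> r * (1 - p)" by simp
      have "max 0 (b - f x) = max 0 (b - x)" for x using ba by (auto simp: f_def)
      then show "expectation (\<lambda>\<omega>. max 0 (b - f (X e \<omega>))) \<le> C"
        unfolding C_def using expectation_transfer[OF e, of "\<lambda>x. max 0 (b - x)"] by simp
    qed
    \<comment> \<open>With n = N |S| edges, C (r q)^(n - 1) equals (C/q) r^(n - 1) q^n. This
      extracts the failure probability q^n, and n \<ge> N bounds the remaining power of r
      independently of S.\<close>
    moreover have "C * (r * (1 - p)) ^ (N * card S - 1)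
        \<le> C / (1 - p) * r ^ (N - 1) * (1 - p) ^ (N * card S)"
    proof -
      have "0 < card S" using S finite_subset[of S "{1..N}"] by (auto simp: card_gt_0_iff)
      then have n: "1 \<le> N * card S" "N - 1 \<le> N * card S - 1" using N by (auto simp: Suc_le_eq diff_le_mono)
      have "(1 - p) ^ (N * card S) = (1 - p) * (1 - p) ^ (N * card S - 1)"
        using n by (metis One_nat_def Suc_diff_le diff_Suc_1 diff_Suc_Suc power_Suc)
      moreover have "r ^ (N * card S - 1) \<le> r ^ (N - 1)"
        using n r0 r(2) by (intro power_decreasing) auto
      ultimately show ?thesis
        using C0 p by (simp add: power_mult_distrib mult_left_mono mult_right_mono)
    qed
    ultimately show ?thesis unfolding C_def[symmetric] by (simp add: algebra_simps)
  qed
  \<comment> \<open>The one-sided limit lemma is applied to the negated process, which is bounded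
    below because each gain is at most \<open>a\<close>.\<close>
  have "- v \<le> - (a - ?D * ?W)"
  proof (rule AE_limit_le_limit_of_expectation)
    let ?Z = "\<lambda>t \<omega>. - ((c + level N (\<lambda>e. f (X e \<omega>)) t) / real t)"
    show "AE \<omega> in M. (\<lambda>t. - (front_max N x0 (\<lambda>i j s. X (i, j, s) \<omega>) t / real t)) \<longlonglongrightarrow> - v"
      using speed by eventually_elim (rule tendsto_minus)
    show "AE \<omega> in M. \<forall>t. - (front_max N x0 (\<lambda>i j s. X (i, j, s) \<omega>) t / real t) \<le> ?Z t \<omega>"
      using AE_values_all
    proof eventually_elim
      case (elim \<omega>)
      have "c + level N (\<lambda>e. f (X e \<omega>)) t \<le> front_max N x0 (\<lambda>i j s. X (i, j, s) \<omega>) t" for t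
      proof (rule level_le_front_max[OF N])
        show "c \<le> x0 i" if "i \<in> {1..N}" for i
          using that unfolding c_def by (intro Min_le) auto
        show "f (X (i, j, s) \<omega>) \<le> X (i, j, s) \<omega>" if "i \<in> {1..N}" "j \<in> {1..N}" "1 \<le> s" for i j s
          using elim[rule_format, of "(i, j, s)"] that by (auto simp: f_def)
      qed
      then show ?case by (auto intro!: divide_right_mono)
    qed
    show "integrable M (?Z t)" for t using integrable_level by simp
    show "- (\<bar>c\<bar> + \<bar>a\<bar>) \<le> ?Z t \<omega>" for t \<omega>
    proof (cases "t = 0")
      case False
      have "level N (\<lambda>e. f (X e \<omega>)) t \<le> a * real t" by (rule level_le)
      moreover have "c \<le> \<bar>c\<bar> * real t" "a * real t \<le> \<bar>a\<bar> * real t"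
        using False mult_left_mono[of 1 "real t" "\<bar>c\<bar>"] mult_right_mono[of a "\<bar>a\<bar>" "real t"]
        by auto
      ultimately have "c + level N (\<lambda>e. f (X e \<omega>)) t \<le> (\<bar>c\<bar> + \<bar>a\<bar>) * real t"
        by (simp only: distrib_right)
      then have "(c + level N (\<lambda>e. f (X e \<omega>)) t) / real t \<le> \<bar>c\<bar> + \<bar>a\<bar>"
        using False by (simp add: pos_divide_le_eq)
      then show ?thesis by linarith
    qed simp
    have "expectation (?Z t) \<le> - (c / real t + (a - ?D * ?W))" if "1 \<le> t" for t
    proof -
      have arith: "a * T - D * (T * W) \<le> L \<Longrightarrow> c + (a - D * W) * T \<le> c + L" for T D W L :: real
        by (simp add: algebra_simps)
      have "(\<Sum>s<t. u N s) \<le> real t * ?W" using sum_bounded_above[of "{..<t}" "u N" ?W] W by simp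
      then have "a * real t - ?D * (real t * ?W) \<le> a * real t - ?D * (\<Sum>s<t. u N s)"
        using D0 by (intro diff_left_mono mult_left_mono) auto
      also have "\<dots> \<le> expectation (\<lambda>\<omega>. level N (\<lambda>e. f (X e \<omega>)) t)"
        by (rule expectation_level_ge[OF gain])
      finally have "c + (a - ?D * ?W) * real t \<le> c + expectation (\<lambda>\<omega>. level N (\<lambda>e. f (X e \<omega>)) t)"
        by (rule arith)
      then have "(c + (a - ?D * ?W) * real t) / real t
          \<le> (c + expectation (\<lambda>\<omega>. level N (\<lambda>e. f (X e \<omega>)) t)) / real t"
        by (rule divide_right_mono) simp
      also have "\<dots> = - expectation (?Z t)"
        using integrable_level by (simp add: prob_space)
      finally show ?thesis using that by (simp add: add_divide_distrib)
    qed
    then show "\<forall>\<^sub>F t in sequentially. expectation (?Z t) \<le> - (c / real t + (a - ?D * ?W))"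
      by (intro eventually_mono[OF eventually_ge_at_top[of "1::nat"]])
    have "(\<lambda>t. - (c / real t + (a - ?D * ?W))) \<longlonglongrightarrow> - (0 + (a - ?D * ?W))"
      by (intro tendsto_intros lim_const_over_n)
    then show "(\<lambda>t. - (c / real t + (a - ?D * ?W))) \<longlonglongrightarrow> - (a - ?D * ?W)"
      by simp
  qed
  then show ?thesis by simp
qed

end

section \<open>Choice of constants and the limit in N\<close>

theorem theorem1p3:
  fixes M :: "'w measure"
    and a b p :: real
    and \<xi> :: "'w \<Rightarrow> real"
    and \<xi>s :: "nat \<Rightarrow> nat \<Rightarrow> nat \<Rightarrow> nat \<Rightarrow> 'w \<Rightarrow> real"
    and X0 :: "nat \<Rightarrow> nat \<Rightarrow> real"
    and v :: "nat \<Rightarrow> real"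
  assumes "prob_space M"
    and "b < a" and "0 < p" and "p < 1"
    and "integrable M \<xi>"
    and "measure M {\<omega> \<in> space M. \<xi> \<omega> > a} = 0"
    and "measure M {\<omega> \<in> space M. b < \<xi> \<omega> \<and> \<xi> \<omega> < a} = 0"
    and "measure M {\<omega> \<in> space M. \<xi> \<omega> = a} = p"
    and "\<And>\<epsilon>. \<epsilon> > 0 \<Longrightarrow> measure M {\<omega> \<in> space M. b - \<epsilon> < \<xi> \<omega> \<and> \<xi> \<omega> \<le> b} > 0"
    and indep: "\<And>N. N \<ge> 1 \<Longrightarrow> prob_space.indep_vars M (\<lambda>_. borel) (\<lambda>(i, j, s). \<xi>s N i j s)
                   ({1..N} \<times> {1..N} \<times> {1..})"
    and ident: "\<And>N i j s. N \<ge> 1 \<Longrightarrow> i \<in> {1..N} \<Longrightarrow> j \<in> {1..N} \<Longrightarrow> s \<ge> 1 \<Longrightarrow>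
                   distr M borel (\<xi>s N i j s) = distr M borel \<xi>"
    and speed: "\<And>N. N \<ge> 1 \<Longrightarrow> AE \<omega> in M.
                   (\<lambda>t. front_max N (X0 N) (\<lambda>i j s. \<xi>s N i j s \<omega>) t / real t) \<longlonglongrightarrow> v N"
  shows "(\<lambda>N. v N - (a - (a - b) * (1 - p) ^ (N\<^sup>2) * 2 ^ N))
           \<in> o(\<lambda>N. (1 - p) ^ (N\<^sup>2) * 2 ^ N)"
proof (rule landau_o.smallI)
  fix \<delta> :: real assume \<delta>: "0 < \<delta>"
  interpret prob_space M by fact
  have front: "iid_front M N \<xi> (\<lambda>(i, j, s). \<xi>s N i j s) (X0 N) a b p (v N)" if "1 \<le> N" for N
    using assms(2-8) indep[OF that] ident[OF that] speed[OF that] that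
    by unfold_locales auto
  define q where "q = 1 - p"
  have q: "0 < q" "q < 1" using \<open>0 < p\<close> \<open>p < 1\<close> by (auto simp: q_def)
  \<comment> \<open>Error budget: the depth \<epsilon> below \<open>b\<close> contributes
    \<delta>/4, and \<eta> is chosen so that 2 K \<eta> (a - b + \<epsilon>) is at most another
    \<delta>/4. The cap p/2 is the condition of the moment recursion.\<close>
  define \<epsilon> where "\<epsilon> = \<delta> / 4"
  define K where "K = 2 / p"
  define \<eta> where "\<eta> = min (p / 2) (\<delta> / (8 * K * (a - b + \<epsilon>)))"
  have \<epsilon>: "0 < \<epsilon>" using \<delta> by (simp add: \<epsilon>_def)
  have K: "0 < K" using \<open>0 < p\<close> by (simp add: K_def)
  have pos: "0 < 8 * K * (a - b + \<epsilon>)" using K \<epsilon> \<open>b < a\<close> by simp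
  have \<eta>: "0 < \<eta>" "\<eta> \<le> p / 2" using \<open>0 < p\<close> \<delta> pos by (auto simp: \<eta>_def)
  have "\<eta> * (8 * K * (a - b + \<epsilon>)) \<le> \<delta>"
  proof -
    have "\<eta> \<le> \<delta> / (8 * K * (a - b + \<epsilon>))" by (simp add: \<eta>_def)
    then show ?thesis using pos by (simp only: pos_le_divide_eq)
  qed
  then have lim_less: "(a - b + \<epsilon>) * (1 + K * (\<eta> * 2)) < a - b + \<delta>"
    using \<delta> by (simp add: \<epsilon>_def algebra_simps)
  \<comment> \<open>R is the midpoint of 1 + q = 2 - p and 2, and y solves R (1 + y) = 2. Then y <
    p, R y = p/2 < 1, and R (q + y) = (2 - p)^2 / 2 < 2, so relative to 2^N only the \<eta> terms
    survive.\<close>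
  define R where "R = (4 - p) / 2"
  define y where "y = p / (4 - p)"
  have p4: "0 < 4 - p" using \<open>p < 1\<close> by simp
  have Ry: "R * y = p / 2" proof -
    have "w / 2 * (p / w) = p / 2" if "w \<noteq> 0" for w :: real using that by simp
    from this[of "4 - p"] show ?thesis using p4 by (simp add: R_def y_def)
  qed
  have R1: "R * (1 + y) = 2" by (simp add: distrib_left Ry) (simp add: R_def field_simps)
  have R2: "R * (1 - p + y) = (2 - p)\<^sup>2 / 2"
    by (simp add: distrib_left Ry) (simp add: R_def power2_eq_square field_simps)
  have y: "0 < y" "y < p"
  proof -
    show "0 < y" using \<open>0 < p\<close> p4 by (simp add: y_def)
    have "p * 1 < p * (4 - p)" using \<open>0 < p\<close> \<open>p < 1\<close> by (intro mult_strict_left_mono) auto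
    then show "y < p" using p4 by (simp add: y_def pos_divide_less_eq)
  qed
  have R: "0 < R" using p4 by (simp add: R_def)
  have ev_key: "\<forall>\<^sub>F N in sequentially. \<forall>s\<ge>1.
      (1 + q ^ s) ^ N - 1 + R ^ N * (y + q ^ s) ^ N \<le> \<eta> * (1 + R ^ N * y ^ s)"
  proof (rule eventually_power_sum_le_weight[OF q \<eta>(1) y(1)])
    show "y + q < 1" using y by (simp add: q_def)
    show "1 + q < R" using \<open>0 < p\<close> by (simp add: q_def R_def)
    show "R * y < 1" using Ry \<open>p < 1\<close> by simp
  qed
  \<comment> \<open>The mass of \<xi> just below \<open>b\<close> enters here: it makes \<rho> < 1,
    so the best of at least N weights conditioned to be at most \<open>b\<close> is rarely below b -
    \<epsilon>.\<close>
  define \<rho> where "\<rho> = prob {\<omega> \<in> space M. \<xi> \<omega> \<le> b - \<epsilon>} / (1 - p)"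
  have \<rho>: "0 \<le> \<rho>" "\<rho> < 1"
  proof -
    \<comment> \<open>Any size would do; the system with N = 1 gives access to
      \<open>prob_le_b\<close>, a statement about \<xi> alone.\<close>
    interpret F: iid_front M 1 \<xi> "\<lambda>(i, j, s). \<xi>s 1 i j s" "X0 1" a b p "v 1" by (rule front) simp
    have "{\<omega> \<in> space M. \<xi> \<omega> \<le> b}
        = {\<omega> \<in> space M. \<xi> \<omega> \<le> b - \<epsilon>} \<union> {\<omega> \<in> space M. b - \<epsilon> < \<xi> \<omega> \<and> \<xi> \<omega> \<le> b}"
      using \<epsilon> by auto
    then have "1 - p = prob {\<omega> \<in> space M. \<xi> \<omega> \<le> b - \<epsilon>} + prob {\<omega> \<in> space M. b - \<epsilon> < \<xi> \<omega> \<and> \<xi> \<omega> \<le> b}"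
      unfolding F.prob_le_b[symmetric] by (simp only:) (rule finite_measure_Union; auto)
    with assms(9)[OF \<epsilon>] show "0 \<le> \<rho>" "\<rho> < 1" using \<open>p < 1\<close> by (auto simp: \<rho>_def)
  qed
  define C where "C = expectation (\<lambda>\<omega>. max 0 (b - \<xi> \<omega>))"
  define D where "D N = a - b + \<epsilon> + C / (1 - p) * \<rho> ^ (N - 1)" for N
  \<comment> \<open>The bound on the failure probability divided by q^(N^2) 2^N; both powers in it
    have base below 1, so \<open>W\<close> tends to 1 + 2 K \<eta>.\<close>
  define W where "W N = (1 + K * (\<eta> * 2 + (((2 - p) / 2) ^ N + ((2 - p)\<^sup>2 / 4) ^ N))) / (1 - q ^ N)" for N
  have "(\<lambda>N. \<rho> ^ (Suc N - 1)) \<longlonglongrightarrow> 0" using \<rho> by (simp add: LIMSEQ_realpow_zero)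
  then have "(\<lambda>N. \<rho> ^ (N - 1)) \<longlonglongrightarrow> 0" by (rule LIMSEQ_imp_Suc)
  then have "D \<longlonglongrightarrow> a - b + \<epsilon> + C / (1 - p) * 0" unfolding D_def by (intro tendsto_intros)
  moreover have "W \<longlonglongrightarrow> (1 + K * (\<eta> * 2 + (0 + 0))) / (1 - 0)"
  proof -
    have "(2 - p)\<^sup>2 < 2\<^sup>2" using \<open>0 < p\<close> \<open>p < 1\<close> by (intro power_strict_mono) auto
    then show ?thesis
      unfolding W_def using q \<open>0 < p\<close> \<open>p < 1\<close> by (intro tendsto_intros LIMSEQ_realpow_zero) auto
  qed
  ultimately have "(\<lambda>N. D N * W N) \<longlonglongrightarrow> (a - b + \<epsilon> + C / (1 - p) * 0) * ((1 + K * (\<eta> * 2 + (0 + 0))) / (1 - 0))"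
    by (rule tendsto_mult)
  then have ev_lower: "\<forall>\<^sub>F N in sequentially. D N * W N < a - b + \<delta>"
    using lim_less by (intro order_tendstoD) simp_all
  \<comment> \<open>The relative error is scaled so that (a - b) (1 - \<delta> / (a - b)) is a - b -
    \<delta>.\<close>
  have ev_upper: "\<forall>\<^sub>F N in sequentially. \<forall>k\<in>{1..N}. (1 - \<delta> / (a - b)) * 2 ^ N * q ^ (N\<^sup>2)
      \<le> (q ^ k + (1 - q ^ k) * q ^ N) ^ N - (q ^ k) ^ N"
    using q \<delta> \<open>b < a\<close> by (intro eventually_one_step_failure_ge) auto
  show "\<forall>\<^sub>F N in sequentially. norm (v N - (a - (a - b) * (1 - p) ^ (N\<^sup>2) * 2 ^ N))
      \<le> \<delta> * norm ((1 - p) ^ (N\<^sup>2) * 2 ^ N)"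
    using ev_key ev_lower ev_upper eventually_ge_at_top[of 1]
  proof eventually_elim
    case (elim N)
    interpret F: iid_front M N \<xi> "\<lambda>(i, j, s). \<xi>s N i j s" "X0 N" a b p "v N"
      using elim(4) by (rule front)
    define Q where "Q = q ^ (N\<^sup>2) * 2 ^ N"
    have Q: "0 < Q" using q by (simp add: Q_def)
    have "v N \<le> a - (a - b) * ((1 - \<delta> / (a - b)) * 2 ^ N * q ^ (N\<^sup>2))"
      using elim(3) unfolding q_def by (intro F.speed_le) blast
    also have "\<dots> = a - (a - b) * (1 - \<delta> / (a - b)) * Q" by (simp add: Q_def)
    also have "(a - b) * (1 - \<delta> / (a - b)) = a - b - \<delta>" using \<open>b < a\<close> by (simp add: field_simps)
    finally have upper: "v N \<le> a - (a - b - \<delta>) * Q" .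
    have "q ^ (N\<^sup>2) * ((2 ^ N + K * (\<eta> * (2 ^ N + (R * (1 + y)) ^ N)
           + ((2 - p) ^ N + (R * (1 - p + y)) ^ N))) / (1 - q ^ N)) = Q * W N"
    proof -
      have "((2 - p)\<^sup>2 / 2) ^ N = 2 ^ N * ((2 - p)\<^sup>2 / 4) ^ N" "(2 - p) ^ N = 2 ^ N * ((2 - p) / 2) ^ N"
        unfolding power_mult_distrib[symmetric] by (rule arg_cong[where f="\<lambda>x. x ^ N"], simp)+
      then have "2 ^ N + K * (\<eta> * (2 ^ N + (R * (1 + y)) ^ N) + ((2 - p) ^ N + (R * (1 - p + y)) ^ N))
          = 2 ^ N * (1 + K * (\<eta> * 2 + (((2 - p) / 2) ^ N + ((2 - p)\<^sup>2 / 4) ^ N)))"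
        unfolding R1 R2 by (simp only:) (simp add: algebra_simps)
      then show ?thesis unfolding Q_def W_def by simp
    qed
    moreover have "a - D N * (q ^ (N\<^sup>2) * ((2 ^ N + K * (\<eta> * (2 ^ N + (R * (1 + y)) ^ N)
           + ((2 - p) ^ N + (R * (1 - p + y)) ^ N))) / (1 - q ^ N))) \<le> v N"
      unfolding D_def C_def K_def q_def
      using elim(1) \<rho> by (intro F.speed_ge \<epsilon> \<rho>_def y(1) R \<eta>) (auto simp: q_def)
    ultimately have "a - D N * (Q * W N) \<le> v N" by simp
    moreover have "D N * (Q * W N) \<le> (a - b + \<delta>) * Q"
      using mult_right_mono[OF less_imp_le[OF elim(2)], of Q] Q by (simp add: mult_ac)
    ultimately have lower: "a - (a - b + \<delta>) * Q \<le> v N" by linarith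
    have "\<bar>v N - (a - (a - b) * Q)\<bar> \<le> \<delta> * Q"
      using upper lower by (auto simp: abs_le_iff algebra_simps)
    then show ?case using Q by (simp add: Q_def q_def mult.assoc)
  qed
qed

end
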